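(* Let $\beta\in(0,1)$ be fixed. There is a constant $C_\beta>0$ depending only on $\beta$ such that for all $T\ge 10^{10}$ and all $\theta\in[0,2\pi]$, \[ \max_{T^{\beta}\le |t|\le T}\ \mathrm{Re}\Big(e^{-{\rm i}\theta}\,\frac{\zeta'}{\zeta}(1+{\rm i}t)\Big)\ \ge\ \log\log T-C_\beta\log\log\log T, \] i.e. the left side is $\ge \log\log T+O_\beta(\log\log\log T)$ uniformly in $\theta\in[0,2\pi]$.
   Context: $\zeta$ is the Riemann zeta function. *)

theory Defs
  imports "HOL-Complex_Analysis.Complex_Analysis"
begin

text \<open>
  The Riemann zeta function, as the analytic continuation of its Dirichlet series to
  the complex plane without \<open>1\<close>. The value at the pole is fixed (arbitrarily) to be
  \<open>0\<close> so that the description is unique; the lemma \<open>ex1_zeta\<close> below shows that such a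
  function exists and is unique.
\<close>

definition is_zeta :: "(complex \<Rightarrow> complex) \<Rightarrow> bool" where
  "is_zeta f \<longleftrightarrow>
     f holomorphic_on (- {1}) \<and>
     (\<forall>s. Re s > 1 \<longrightarrow> (\<lambda>n. 1 / of_nat (Suc n) powr s) sums f s) \<and>
     f 1 = 0"

definition zeta :: "complex \<Rightarrow> complex" where
  "zeta = (THE f. is_zeta f)"

context
begin

text \<open>
  Existence: for \<open>w = 1 - s\<close>, summing the Taylor expansion of \<open>(n + 1) powr w\<close> at \<open>n\<close> over
  all \<open>n\<close> expresses \<open>(s - 1) * zeta s\<close> through the values at \<open>s + 1, s + 2, \<dots>\<close> and a
  remainder that is holomorphic in a larger half-plane.
\<close>

private definition ff :: "nat \<Rightarrow> complex \<Rightarrow> complex" where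
  "ff i w = (\<Prod>j<i. w - of_nat j)"

private definition zrem :: "nat \<Rightarrow> nat \<Rightarrow> complex \<Rightarrow> complex" where
  "zrem K n w = of_nat (Suc (Suc n)) powr w
     - (\<Sum>i\<le>K. ff i w * of_nat (Suc n) powr (w - of_nat i) / fact i)"

private definition zser :: "complex \<Rightarrow> complex" where
  "zser s = (\<Sum>n. of_nat (Suc n) powr (-s))"

private lemma holomorphic_ff [holomorphic_intros]:
  "f holomorphic_on A \<Longrightarrow> (\<lambda>s. ff i (f s)) holomorphic_on A"
  unfolding ff_def by (intro holomorphic_intros)

private lemma norm_zrem_le:
  assumes "Re w \<le> real K + 1"
  shows "norm (zrem K n w) \<le> norm (ff (Suc K) w) * real (Suc n) powr (Re w - real K - 1)"
proof -
  define a where "a = complex_of_real (real (Suc n))"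
  define b where "b = complex_of_real (real (Suc (Suc n)))"
  let ?S = "closed_segment a b"
  let ?f = "\<lambda>i z. ff i w * z powr (w - of_nat i)"
  let ?B = "norm (ff (Suc K) w) * real (Suc n) powr (Re w - real K - 1)"
  have S: "\<exists>x. z = of_real x \<and> real (Suc n) \<le> x" if "z \<in> ?S" for z
    using that unfolding a_def b_def closed_segment_of_real
    by (auto simp: closed_segment_eq_real_ivl split: if_splits)
  have "cmod (?f 0 b - (\<Sum>i\<le>K. ?f i a * (b - a) ^ i / fact i))
          \<le> ?B * cmod (b - a) ^ Suc K / fact K"
  proof (rule complex_Taylor[of ?S K ?f ?B a b])
    fix i z assume "z \<in> ?S" "i \<le> K"
    then obtain x where x: "z = of_real x" "real (Suc n) \<le> x"
      using S by blast
    have "z \<notin> \<real>\<^sub>\<le>\<^sub>0"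
      using x by (simp add: complex_nonpos_Reals_iff)
    hence "((\<lambda>z. z powr (w - of_nat i)) has_field_derivative
             (w - of_nat i) * z powr (w - of_nat i - 1)) (at z)"
      by (rule has_field_derivative_powr)
    hence "(?f i has_field_derivative ff i w * ((w - of_nat i) * z powr (w - of_nat i - 1))) (at z)"
      by (rule DERIV_cmult)
    also have "ff i w * ((w - of_nat i) * z powr (w - of_nat i - 1)) = ?f (Suc i) z"
      by (simp add: ff_def algebra_simps)
    finally show "(?f i has_field_derivative ?f (Suc i) z) (at z within ?S)"
      by (rule has_field_derivative_at_within)
  next
    fix z assume "z \<in> ?S"
    then obtain x where x: "z = of_real x" "real (Suc n) \<le> x"
      using S by blast
    have "norm (z powr (w - of_nat (Suc K))) = x powr (Re w - real K - 1)"
      using x by (subst norm_powr_real_powr) (auto simp: algebra_simps)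
    also have "\<dots> \<le> real (Suc n) powr (Re w - real K - 1)"
      using x assms by (intro powr_mono2') auto
    finally show "cmod (?f (Suc K) z) \<le> ?B"
      by (simp add: norm_mult mult_left_mono)
  qed auto
  also have "b - a = 1"
    by (simp add: a_def b_def)
  also have "?B * cmod 1 ^ Suc K / fact K \<le> ?B / 1"
    unfolding norm_one power_one mult_1_right
    by (intro divide_left_mono fact_ge_1 mult_nonneg_nonneg) auto
  finally show ?thesis
    by (simp add: zrem_def a_def b_def ff_def)
qed

private lemma zrem_holomorphic:
  "\<exists>g. g holomorphic_on {s. Re s > 1 - real K} \<and>
       (\<forall>s. Re s > 1 - real K \<longrightarrow> (\<lambda>n. zrem K n (1 - s)) sums g s)"
proof -
  let ?S = "{s. Re s > 1 - real K}"
  have opn: "open ?S"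
    by (rule open_halfspace_Re_gt)
  obtain g where g: "\<forall>s\<in>?S. ((\<lambda>n. zrem K n (1 - s)) sums g s) \<and> g field_differentiable (at s)"
  proof (rule series_differentiable_comparison_complex[OF opn, where f = "\<lambda>n s. zrem K n (1 - s)"])
    fix n s assume "s \<in> ?S"
    have "(\<lambda>s. zrem K n (1 - s)) holomorphic_on UNIV"
      unfolding zrem_def by (intro holomorphic_intros) auto
    thus "(\<lambda>s. zrem K n (1 - s)) field_differentiable at s"
      by (auto simp: holomorphic_on_def)
  next
    fix s assume s: "s \<in> ?S"
    define d where "d = (Re s - (1 - real K)) / 2"
    have d: "d > 0" using s by (simp add: d_def)
    have "compact ((\<lambda>s. ff (Suc K) (1 - s)) ` cball s d)"
      by (intro compact_continuous_image holomorphic_on_imp_continuous_on holomorphic_intros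
            compact_cball)
    hence "bounded ((\<lambda>s. ff (Suc K) (1 - s)) ` cball s d)"
      by (rule compact_imp_bounded)
    then obtain B where B: "\<And>y. y \<in> cball s d \<Longrightarrow> norm (ff (Suc K) (1 - y)) \<le> B"
      unfolding bounded_iff by blast
    have B0: "B \<ge> 0"
      using d by (intro order_trans[OF norm_ge_zero B[of s]]) simp
    define h where "h = (\<lambda>n. complex_of_real (B * real (Suc n) powr (- 1 - d)))"
    have le: "norm (zrem K n (1 - y)) \<le> norm (h n)" if y: "y \<in> ball s d" for n y
    proof -
      have "\<bar>Re (s - y)\<bar> \<le> norm (s - y)"
        by (rule abs_Re_le_cmod)
      also have "\<dots> < d" using y by (simp add: dist_norm)
      finally have "Re s - Re y < d" by simp
      moreover have "Re s = 1 - real K + 2 * d" by (simp add: d_def diff_divide_distrib)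
      ultimately have Re_y: "Re y > (1 - real K) + d" by linarith
      have "norm (zrem K n (1 - y)) \<le>
              norm (ff (Suc K) (1 - y)) * real (Suc n) powr (Re (1 - y) - real K - 1)"
        by (rule norm_zrem_le) (use Re_y d in auto)
      also have "\<dots> \<le> B * real (Suc n) powr (- 1 - d)"
        using y B0 Re_y by (intro mult_mono B powr_mono) auto
      finally show ?thesis
        using B0 by (simp add: h_def norm_mult abs_mult)
    qed
    have "summable (\<lambda>n. real n powr (- 1 - d))"
      using d by (subst summable_real_powr_iff) auto
    hence "summable (\<lambda>n. B * real (Suc n) powr (- 1 - d))"
      by (intro summable_mult) (subst summable_Suc_iff)
    hence "summable h"
      unfolding h_def by (subst summable_complex_of_real)
    moreover have "range h \<subseteq> \<real>\<^sub>\<ge>\<^sub>0"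
      using B0 by (auto simp: h_def simp del: of_real_mult)
    ultimately show "\<exists>d h. 0 < d \<and> summable h \<and> range h \<subseteq> \<real>\<^sub>\<ge>\<^sub>0 \<and>
        (\<forall>\<^sub>F n in sequentially. \<forall>y\<in>ball s d \<inter> ?S. cmod (zrem K n (1 - y)) \<le> cmod (h n))"
      using d le by (intro exI[of _ d] exI[of _ h]) auto
  qed auto
  have "g holomorphic_on ?S"
    using g opn by (auto simp: holomorphic_on_open field_differentiable_def)
  thus ?thesis using g by auto
qed

private lemma zser_sums:
  assumes "Re s > 1"
  shows "(\<lambda>n. of_nat (Suc n) powr (-s)) sums zser s"
proof -
  have "summable (\<lambda>n. real n powr (- Re s))"
    using assms by (subst summable_real_powr_iff) auto
  hence "summable (\<lambda>n. real (Suc n) powr (- Re s))"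
    by (subst summable_Suc_iff)
  also have "(\<lambda>n. real (Suc n) powr (- Re s)) = (\<lambda>n. norm (of_nat (Suc n) powr (-s) :: complex))"
    by (intro ext, subst norm_powr_real_powr) auto
  finally have "summable (\<lambda>n. of_nat (Suc n) powr (-s) :: complex)"
    by (rule summable_norm_cancel)
  thus ?thesis unfolding zser_def by (rule summable_sums)
qed

private lemma zser_eq:
  assumes s: "Re s > 1" and K: "K \<ge> 1"
  assumes g: "(\<lambda>n. zrem K n (1 - s)) sums g"
  shows "(s - 1) * zser s =
           1 + g - (\<Sum>i=2..K. ff (i - 1) (1 - s) / fact i * ((s + of_nat (i - 1) - 1) * zser (s + of_nat (i - 1))))"
proof -
  define w where "w = 1 - s"
  have lim: "(\<lambda>n. of_nat (Suc n) powr w :: complex) \<longlonglongrightarrow> 0"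
  proof (rule tendsto_norm_zero_cancel)
    have "(\<lambda>n. real (Suc n) powr Re w) \<longlonglongrightarrow> 0"
      using s by (intro tendsto_neg_powr filterlim_compose[OF filterlim_real_sequentially filterlim_Suc])
         (auto simp: w_def)
    also have "(\<lambda>n. real (Suc n) powr Re w) = (\<lambda>n. norm (of_nat (Suc n) powr w :: complex))"
      by (intro ext, subst norm_powr_real_powr) auto
    finally show "(\<lambda>n. norm (of_nat (Suc n) powr w :: complex)) \<longlonglongrightarrow> 0" .
  qed
  have tel: "(\<lambda>n. of_nat (Suc (Suc n)) powr w - of_nat (Suc n) powr w :: complex) sums (-1)"
    using telescope_sums[OF lim] by simp
  have ser: "(\<lambda>n. of_nat (Suc n) powr (w - of_nat i)) sums zser (s + of_nat (i - 1))"
    if "i \<in> {1..K}" for i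
  proof -
    have "w - of_nat i = -(s + of_nat (i - 1))"
      using that by (simp add: w_def of_nat_diff)
    thus ?thesis
      using zser_sums[of "s + of_nat (i - 1)"] s by simp
  qed
  have "(\<lambda>n. \<Sum>i=1..K. ff i w / fact i * of_nat (Suc n) powr (w - of_nat i)) sums
          (\<Sum>i=1..K. ff i w / fact i * zser (s + of_nat (i - 1)))"
    by (intro sums_sum sums_mult ser)
  from sums_diff[OF tel this]
  have "(\<lambda>n. of_nat (Suc (Suc n)) powr w - of_nat (Suc n) powr w -
          (\<Sum>i=1..K. ff i w / fact i * of_nat (Suc n) powr (w - of_nat i))) sums
          (-1 - (\<Sum>i=1..K. ff i w / fact i * zser (s + of_nat (i - 1))))" .
  also have "(\<lambda>n. of_nat (Suc (Suc n)) powr w - of_nat (Suc n) powr w -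
          (\<Sum>i=1..K. ff i w / fact i * of_nat (Suc n) powr (w - of_nat i))) = (\<lambda>n. zrem K n w)"
  proof
    fix n
    have "{..K} = insert 0 {1..K}" by auto
    thus "of_nat (Suc (Suc n)) powr w - of_nat (Suc n) powr w -
          (\<Sum>i=1..K. ff i w / fact i * of_nat (Suc n) powr (w - of_nat i)) = zrem K n w"
      by (simp add: zrem_def ff_def algebra_simps)
  qed
  finally have "g = -1 - (\<Sum>i=1..K. ff i w / fact i * zser (s + of_nat (i - 1)))"
    using g sums_unique2 unfolding w_def by blast
  also have "{1..K} = insert 1 {2..K}" using K by auto
  also have "(\<Sum>i\<in>insert 1 {2..K}. ff i w / fact i * zser (s + of_nat (i - 1))) =
     w * zser s + (\<Sum>i=2..K. ff i w / fact i * zser (s + of_nat (i - 1)))"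
    by (simp add: ff_def)
  also have "(\<Sum>i=2..K. ff i w / fact i * zser (s + of_nat (i - 1))) =
     -(\<Sum>i=2..K. ff (i - 1) w / fact i * ((s + of_nat (i - 1) - 1) * zser (s + of_nat (i - 1))))"
    unfolding sum_negf [symmetric]
  proof (rule sum.cong)
    fix i assume i: "i \<in> {2..K}"
    then obtain j where j: "i = Suc j" by (cases i) auto
    have "ff i w = - (ff (i - 1) w * (s + of_nat (i - 1) - 1))"
      by (simp add: j ff_def w_def algebra_simps)
    thus "ff i w / fact i * zser (s + of_nat (i - 1)) =
      - (ff (i - 1) w / fact i * ((s + of_nat (i - 1) - 1) * zser (s + of_nat (i - 1))))"
      by simp
  qed auto
  finally show ?thesis by (simp add: w_def algebra_simps)
qed

private lemma zser_holomorphic: "zser holomorphic_on {s. Re s > 1}"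
proof -
  obtain g where g: "g holomorphic_on {s. Re s > 1 - real 1}"
    "\<And>s. Re s > 1 - real 1 \<Longrightarrow> (\<lambda>n. zrem 1 n (1 - s)) sums g s"
    using zrem_holomorphic[of 1] by blast
  have "(\<lambda>s. (1 + g s) / (s - 1)) holomorphic_on {s. Re s > 1}"
    by (intro holomorphic_intros holomorphic_on_subset[OF g(1)]) auto
  moreover have "(1 + g s) / (s - 1) = zser s" if "Re s > 1" for s
  proof -
    have "s \<noteq> 1" using that by auto
    thus ?thesis using zser_eq[OF that order_refl g(2)] that by (simp add: field_simps)
  qed
  ultimately show ?thesis
    by (auto intro: holomorphic_transform)
qed

private lemma halfplane_continuation:
  "\<exists>h. h holomorphic_on {s. Re s > 1 - real m} \<and> (\<forall>s. Re s > 1 \<longrightarrow> h s = (s - 1) * zser s)"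
proof (induction m)
  case 0
  have "(\<lambda>s. (s - 1) * zser s) holomorphic_on {s. Re s > 1 - real 0}"
    using zser_holomorphic by (auto intro!: holomorphic_intros)
  thus ?case by blast
next
  case (Suc m)
  then obtain h where h: "h holomorphic_on {s. Re s > 1 - real m}"
    "\<And>s. Re s > 1 \<Longrightarrow> h s = (s - 1) * zser s" by blast
  define K where "K = m + 2"
  obtain g where g: "g holomorphic_on {s. Re s > 1 - real K}"
    "\<And>s. Re s > 1 - real K \<Longrightarrow> (\<lambda>n. zrem K n (1 - s)) sums g s"
    using zrem_holomorphic[of K] by blast
  let ?h = "\<lambda>s. 1 + g s - (\<Sum>i=2..K. ff (i - 1) (1 - s) / fact i * h (s + of_nat (i - 1)))"
  have "(h \<circ> (\<lambda>s. s + of_nat (i - 1))) holomorphic_on {s. Re s > 1 - real (Suc m)}"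
    if "i \<in> {2..K}" for i
    using that by (intro holomorphic_on_compose_gen[OF _ h(1)] holomorphic_intros) (auto simp: of_nat_diff)
  hence "?h holomorphic_on {s. Re s > 1 - real (Suc m)}"
    by (intro holomorphic_intros holomorphic_on_subset[OF g(1)])
       (auto simp: K_def o_def)
  moreover have "?h s = (s - 1) * zser s" if "Re s > 1" for s
  proof -
    have "(\<lambda>n. zrem K n (1 - s)) sums g s"
      using that by (intro g(2)) (auto simp: K_def)
    from zser_eq[OF that _ this] show ?thesis
      using that by (auto simp: h(2) K_def)
  qed
  ultimately show ?case by blast
qed

private lemma ex_zeta: "\<exists>f. is_zeta f"
proof -
  obtain h where h: "\<And>m. h m holomorphic_on {s. Re s > 1 - real m}"
    "\<And>m s. Re s > 1 \<Longrightarrow> h m s = (s - 1) * zser s"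
    using halfplane_continuation by metis
  have agree: "h m s = h n s" if "m \<le> n" "Re s > 1 - real m" for m n s
  proof -
    have "h m s - h n s = 0"
    proof (rule analytic_continuation_open[of "{s. Re s > 1}" "{s. Re s > 1 - real m}"
            "\<lambda>s. h m s - h n s" "\<lambda>_. 0"])
      show "(\<lambda>s. h m s - h n s) holomorphic_on {s. Re s > 1 - real m}"
        using that by (intro holomorphic_intros h(1) holomorphic_on_subset[OF h(1)[of n]]) auto
      show "{s::complex. Re s > 1} \<noteq> {}"
        by (auto intro!: exI[of _ "2::complex"])
      show "connected {s. Re s > 1 - real m}"
        by (intro convex_connected convex_halfspace_Re_gt)
    qed (use that h(2) in \<open>auto simp: open_halfspace_Re_gt\<close>)
    thus ?thesis by simp
  qed
  define H where "H = (\<lambda>s. h (nat \<lceil>2 - Re s\<rceil>) s)"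
  have H_eq: "H s = h m s" if "Re s > 1 - real m" for m s
  proof -
    have "Re s > 1 - real (nat \<lceil>2 - Re s\<rceil>)" by linarith
    thus ?thesis unfolding H_def using agree that by (metis nat_le_linear)
  qed
  have "H holomorphic_on UNIV"
  proof -
    have "H holomorphic_on (\<Union>m. {s. Re s > 1 - real m})"
    proof (rule holomorphic_on_UN_open)
      fix m
      show "H holomorphic_on {s. Re s > 1 - real m}"
        by (rule holomorphic_transform[OF h(1)]) (simp add: H_eq)
    qed (auto simp: open_halfspace_Re_gt)
    also have "(\<Union>m. {s. Re s > 1 - real m}) = UNIV"
    proof safe
      fix s :: complex
      have "Re s > 1 - real (nat \<lceil>2 - Re s\<rceil>)" by linarith
      thus "s \<in> (\<Union>m. {s. Re s > 1 - real m})" by blast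
    qed auto
    finally show ?thesis .
  qed
  hence "H holomorphic_on (- {1})"
    by (rule holomorphic_on_subset) simp
  hence "(\<lambda>s. H s / (s - 1)) holomorphic_on (- {1})"
    by (intro holomorphic_intros) auto
  moreover have "(\<lambda>n. 1 / of_nat (Suc n) powr s) sums (H s / (s - 1))" if "Re s > 1" for s
  proof -
    have "s \<noteq> 1" using that by auto
    hence "H s / (s - 1) = zser s"
      using H_eq[of 0 s] h(2)[of s 0] that by simp
    thus ?thesis using zser_sums[OF that] by (simp add: powr_minus inverse_eq_divide)
  qed
  ultimately have "is_zeta (\<lambda>s. H s / (s - 1))"
    unfolding is_zeta_def by auto
  thus ?thesis by blast
qed

lemma ex1_zeta: "\<exists>!f. is_zeta f"
proof (rule ex_ex1I)
  show "\<exists>f. is_zeta f" by (rule ex_zeta)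
next
  fix f g assume fg: "is_zeta f" "is_zeta g"
  show "f = g"
  proof
    fix s
    show "f s = g s"
    proof (cases "s = 1")
      case False
      show ?thesis
      proof (rule analytic_continuation_open[of "{s. Re s > 1}" "- {1}" f g])
        show "{s::complex. Re s > 1} \<noteq> {}"
          by (auto intro!: exI[of _ "2::complex"])
        show "connected (- {1::complex})"
          by (rule connected_punctured_universe) auto
        show "f z = g z" if "z \<in> {s. Re s > 1}" for z
          using that fg sums_unique2 unfolding is_zeta_def by blast
      qed (use fg False in \<open>auto simp: is_zeta_def open_halfspace_Re_gt\<close>)
    qed (use fg in \<open>auto simp: is_zeta_def\<close>)
  qed
qed

end

lemma is_zeta_zeta: "is_zeta zeta"
  unfolding zeta_def by (rule theI'[OF ex1_zeta])

end

theory Submission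
  imports Defs "HOL-Number_Theory.Prime_Powers" "HOL-Real_Asymp.Real_Asymp"
begin

text \<open>
  Resonance method with a compactly supported kernel. Let \<open>w = - e^(i \<theta>)\<close> and let
  \<open>R t = (\<Sum>n | n dvd Q. w ^ \<Omega> n * n powr (i t))\<close> with \<open>Q = (y!) ^ L\<close>. On \<open>[T\<^sup>\<beta>, T]\<close> use the
  weight \<open>|R t|\<^sup>2 (1 - cos ((t - T\<^sup>\<beta>) / W))\<close>, whose cosine factor runs through one period.
  Integrating it against \<open>Re (cnj w * (- \<zeta>'/\<zeta>)(\<sigma> + i t)) = Re (cnj w * (\<Sum>k. \<Lambda> k k powr (- \<sigma> - i t)))\<close>
  for \<open>\<sigma> > 1\<close>, the diagonal \<open>m = n k\<close> contributes with weight \<open>1\<close> for primes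
  \<open>k\<close>, hence about \<open>(\<Sum>p\<le>y. ln p / p) = ln y + O(1)\<close>, while prime powers contribute \<open>O(1)\<close>.
  The transform of the kernel at frequency \<open>x\<close> is \<open>O(1 / (W\<^sup>2 |x|\<^sup>3))\<close>, so that the off-diagonal terms
  are controlled by \<open>\<Sum>k. 1 / (k (1 + ln k)\<^sup>2)\<close> uniformly as \<open>\<sigma>\<close> tends to \<open>1\<close>, provided that \<open>Q\<close>
  is at most a small power of \<open>T\<close>. This allows \<open>y\<close> of size \<open>ln T / (ln ln T)\<^sup>2\<close> and \<open>L\<close> of size \<open>ln ln T\<close>.
\<close>

section \<open>Dirichlet series and non-vanishing of zeta on the line of real part 1\<close>

text \<open>A nonnegative weight turns the maximum into a weighted mean, and since the kernel lives
  on the window itself, nothing about zeta at other heights is needed: no growth bound, no contour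
  shift, no contribution of the pole. The price is a slowly decaying transform. A sharp cut-off
  would decay only like \<open>1 / |x|\<close>, and the sum of
  \<open>mangoldt k / (k * (1 + ln k))\<close> diverges. Since \<open>1 - cos\<close> has a double
  zero at both ends of its period, the decay is cubic, and then even the trivial bound
  \<open>mangoldt k \<le> ln k\<close> gives convergence. Letting \<sigma> tend to 1 needs only
  continuity of the logarithmic derivative up to the line, hence non-vanishing there. The
  frequencies \<open>ln (m / (n * k))\<close> can be as small as a negative power of
  \<open>Q\<close>, so \<open>W\<close> must exceed a fixed power of \<open>Q\<close>. As
  \<open>ln Q\<close> is at most \<open>L * y * ln y\<close>, this fixes the scale of
  \<open>y\<close>; the two powers of \<open>ln (ln T)\<close> that \<open>y\<close> gives up
  produce the term in \<open>ln (ln (ln T))\<close>. Taking \<open>L\<close> at least about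
  \<open>ln y\<close> keeps the loss from divisors that already contain \<open>p ^ L\<close>
  bounded.\<close>

lemma summable_ln_powr:
  fixes \<sigma> :: real
  assumes "\<sigma> > 1"
  shows "summable (\<lambda>k. ln (real k) * real k powr - \<sigma>)"
proof -
  define e where "e = (\<sigma> - 1) / 2"
  have e: "e > 0" using assms by (simp add: e_def)
  have "summable (\<lambda>k. real k powr (e - \<sigma>) / e)"
    using assms e by (intro summable_divide) (auto simp: summable_real_powr_iff e_def field_simps)
  thus ?thesis
  proof (rule summable_comparison_test_ev[rotated], intro eventually_sequentiallyI)
    fix k :: nat assume k: "k \<ge> 1"
    have "ln (real k) * real k powr - \<sigma> \<le> (real k powr e / e) * real k powr - \<sigma>"
      using k e by (intro mult_right_mono ln_powr_bound) auto
    also have "\<dots> = real k powr (e - \<sigma>) / e"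
      by (simp add: powr_add[symmetric])
    finally show "norm (ln (real k) * real k powr - \<sigma>) \<le> real k powr (e - \<sigma>) / e"
      using k by simp
  qed
qed

lemma mangoldt_le_ln: "mangoldt n \<le> ln (real n)"
proof (cases "primepow n")
  case True
  hence n: "n > 1" "aprimedivisor n dvd n" "prime (aprimedivisor n)"
    using primepow_gt_Suc_0[OF True] by (auto intro!: prime_aprimedivisor' aprimedivisor_dvd')
  hence "aprimedivisor n \<le> n" by (auto intro: dvd_imp_le)
  thus ?thesis using True n by (simp add: mangoldt_def prime_gt_0_nat)
qed (cases "n = 0"; simp add: mangoldt_def)

lemma summable_mangoldt_powr:
  fixes \<sigma> :: real
  assumes "\<sigma> > 1"
  shows "summable (\<lambda>k. mangoldt k * real k powr - \<sigma>)"
  by (rule summable_comparison_test'[OF summable_ln_powr[OF assms], of 0])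
     (auto simp: abs_mult mangoldt_le_ln intro!: mult_right_mono)

lemma norm_nat_powr: "norm (of_nat k powr s :: complex) = real k powr Re s"
  by (cases "k = 0") (auto simp: norm_powr_real_powr)

section \<open>Termwise differentiation and multiplication of Dirichlet series\<close>

text \<open>Local domination: on the ball around \<open>s\<close> whose radius \<open>d\<close> is
  half the distance to the line of real part 1, the real parts stay above \<open>1 + d\<close>, so
  the series at that abscissa is a majorant.\<close>

lemma dirichlet_series_deriv:
  fixes a :: "nat \<Rightarrow> complex"
  assumes sm: "\<And>\<sigma>. \<sigma> > 1 \<Longrightarrow> summable (\<lambda>k. norm (a k) * real k powr - \<sigma>)"
    and s: "Re s > 1"
  shows "((\<lambda>s. \<Sum>k. a k * of_nat k powr - s) has_field_derivative
           (\<Sum>k. - of_real (ln k) * a k * of_nat k powr - s)) (at s)"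
    and "summable (\<lambda>k. - of_real (ln k) * a k * of_nat k powr - s)"
proof -
  let ?S = "{s::complex. Re s > 1}"
  have "\<exists>g g'. \<forall>s\<in>?S. ((\<lambda>k. a k * of_nat k powr - s) sums g s) \<and>
        ((\<lambda>k. - of_real (ln k) * a k * of_nat k powr - s) sums g' s) \<and> (g has_field_derivative g' s) (at s)"
  proof (rule series_and_derivative_comparison_complex)
    show "open ?S" by (rule open_halfspace_Re_gt)
  next
    fix k s assume "s \<in> ?S"
    show "((\<lambda>s. a k * of_nat k powr - s) has_field_derivative
             - of_real (ln (real k)) * a k * of_nat k powr - s) (at s)"
    proof (cases "k = 0")
      case False
      hence "((\<lambda>s. a k * exp (- s * of_real (ln (real k)))) has_field_derivative
             - of_real (ln (real k)) * a k * exp (- s * of_real (ln (real k)))) (at s)"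
        by (auto intro!: derivative_eq_intros)
      thus ?thesis using False by (simp add: powr_def Ln_of_nat)
    qed simp
  next
    fix s assume s: "s \<in> ?S"
    define d where "d = (Re s - 1) / 2"
    have d: "d > 0" "1 + d > 1" using s by (auto simp: d_def)
    have *: "norm (a k * of_nat k powr - y) \<le> norm (a k) * real k powr - (1 + d)"
      if y: "y \<in> ball s d" for y k
    proof (cases "k = 0")
      case False
      have "\<bar>Re (s - y)\<bar> \<le> norm (s - y)"
        by (rule abs_Re_le_cmod)
      hence "Re y \<ge> 1 + d"
        using y by (simp add: d_def dist_norm field_simps)
      thus ?thesis using False
        by (auto simp: norm_mult norm_nat_powr intro!: mult_left_mono powr_mono)
    qed simp
    show "\<exists>d h. 0 < d \<and> summable h \<and> range h \<subseteq> \<real>\<^sub>\<ge>\<^sub>0 \<and>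
      (\<forall>\<^sub>F n in sequentially. \<forall>y\<in>ball s d \<inter> ?S. cmod (a n * of_nat n powr - y) \<le> cmod (h n))"
    proof (intro exI[of _ d] exI[of _ "\<lambda>k. of_real (norm (a k) * real k powr - (1 + d))"] conjI)
      show "summable (\<lambda>k. complex_of_real (norm (a k) * real k powr - (1 + d)))"
        using sm[OF d(2)] by (subst summable_complex_of_real)
      show "range (\<lambda>k. complex_of_real (norm (a k) * real k powr - (1 + d))) \<subseteq> \<real>\<^sub>\<ge>\<^sub>0"
        by (auto simp del: of_real_mult)
      show "\<forall>\<^sub>F n in sequentially. \<forall>y\<in>ball s d \<inter> ?S.
         cmod (a n * of_nat n powr - y) \<le> cmod (complex_of_real (norm (a n) * real n powr - (1 + d)))"
        using * by (intro always_eventually) (auto simp: abs_mult simp del: of_real_mult)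
    qed (use d in auto)
  qed
  then obtain g g' where g:
    "\<And>s. Re s > 1 \<Longrightarrow> (\<lambda>k. a k * of_nat k powr - s) sums g s"
    "\<And>s. Re s > 1 \<Longrightarrow> (\<lambda>k. - of_real (ln k) * a k * of_nat k powr - s) sums g' s"
    "\<And>s. Re s > 1 \<Longrightarrow> (g has_field_derivative g' s) (at s)" by auto
  show "((\<lambda>s. \<Sum>k. a k * of_nat k powr - s) has_field_derivative
           (\<Sum>k. - of_real (ln k) * a k * of_nat k powr - s)) (at s)"
    unfolding sums_unique[OF g(2)[OF s], symmetric] using g(3)[OF s]
  proof (rule has_field_derivative_transform_within_open)
    show "g z = (\<Sum>k. a k * of_nat k powr - z)" if "z \<in> ?S" for z
      using g(1)[of z] that by (intro sums_unique) auto
  qed (use s in \<open>auto simp: open_halfspace_Re_gt\<close>)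
  show "summable (\<lambda>k. - of_real (ln k) * a k * of_nat k powr - s)"
    using g(2)[OF s] by (rule sums_summable)
qed

text \<open>Absolute convergence permits regrouping the sum over pairs \<open>(k, m)\<close>
  according to \<open>n = k * m\<close>.\<close>

lemma dirichlet_series_product:
  fixes a b :: "nat \<Rightarrow> complex" and s :: complex
  assumes a: "summable (\<lambda>k. norm (a k) * real k powr - Re s)"
    and b: "summable (\<lambda>k. norm (b k) * real k powr - Re s)"
  shows "(\<lambda>n. (\<Sum>d | d dvd n. a d * b (n div d)) * of_nat n powr - s) sums
           ((\<Sum>k. a k * of_nat k powr - s) * (\<Sum>k. b k * of_nat k powr - s))"
proof -
  define A where "A = (\<lambda>k. a k * of_nat k powr - s)"
  define B where "B = (\<lambda>k. b k * of_nat k powr - s)"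
  have sA: "summable (\<lambda>k. norm (A k))" and sB: "summable (\<lambda>k. norm (B k))"
    using a b by (auto simp: A_def B_def norm_mult norm_nat_powr)
  \<comment> \<open>Index 0 is removed before regrouping, because every number divides it; its terms
    vanish anyway, as \<open>0 powr z = 0\<close>.\<close>
  have hA: "(A has_sum suminf A) {0<..}"
  proof -
    have "(A has_sum suminf A) UNIV"
      by (intro norm_summable_imp_has_sum sA summable_sums summable_norm_cancel[OF sA])
    thus ?thesis by (rule has_sum_cong_neutral[THEN iffD1, rotated -1]) (auto simp: A_def)
  qed
  have hB: "(B has_sum suminf B) {0<..}"
  proof -
    have "(B has_sum suminf B) UNIV"
      by (intro norm_summable_imp_has_sum sB summable_sums summable_norm_cancel[OF sB])
    thus ?thesis by (rule has_sum_cong_neutral[THEN iffD1, rotated -1]) (auto simp: B_def)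
  qed
  have nA: "(\<lambda>k. norm (A k)) summable_on {0<..}" and nB: "(\<lambda>k. norm (B k)) summable_on {0<..}"
    using norm_summable_imp_summable_on[of "\<lambda>k. norm (A k)"] norm_summable_imp_summable_on[of "\<lambda>k. norm (B k)"]
      sA sB by (auto intro: summable_on_subset_banach)
  have "(\<lambda>z. norm (case z of (x, y) \<Rightarrow> A x * B y)) summable_on {0<..} \<times> {0<..}"
    unfolding Infinite_Sum.abs_summable_on_Sigma_iff
  proof (intro conjI ballI)
    fix x show "(\<lambda>y. norm (case (x, y) of (x, y) \<Rightarrow> A x * B y)) summable_on {0<..}"
      using nB by (auto simp: norm_mult intro!: summable_on_cmult_right)
  next
    show "(\<lambda>x. norm (\<Sum>\<^sub>\<infinity>y\<in>{0<..}. norm (case (x, y) of (x, y) \<Rightarrow> A x * B y))) summable_on {0<..}"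
      using nA by (auto simp: norm_mult abs_mult infsum_cmult_right' intro!: summable_on_cmult_left)
  qed
  hence smm: "(\<lambda>(x, y). A x * B y) summable_on {0<..} \<times> {0<..}"
    by (rule abs_summable_summable)
  have "((\<lambda>(x, y). A x * B y) has_sum (suminf A * suminf B)) ({0<..} \<times> {0<..})"
  proof (rule has_sum_SigmaI[OF _ _ smm])
    show "((\<lambda>y. case (x, y) of (x, y) \<Rightarrow> A x * B y) has_sum (A x * suminf B)) {0<..}" for x
      using hB by (auto intro: has_sum_cmult_right)
    show "((\<lambda>x. A x * suminf B) has_sum suminf A * suminf B) {0<..}"
      using hA by (rule has_sum_cmult_left)
  qed
  also have "((\<lambda>(x, y). A x * B y) has_sum (suminf A * suminf B)) ({0<..} \<times> {0<..}) \<longleftrightarrow>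
     ((\<lambda>(n, d). a d * b (n div d) * of_nat n powr - s) has_sum (suminf A * suminf B))
        (SIGMA n:{0<..}. {d. d dvd n})"
  proof (rule has_sum_reindex_bij_witness[of _ "\<lambda>(n, d). (d, n div d)" "\<lambda>(k, m). (k * m, k)"]; clarsimp)
    fix k m :: nat assume km: "k > 0" "m > 0"
    show "a k * b m * (of_nat k * of_nat m) powr - s = A k * B m"
      using km by (simp add: A_def B_def powr_times_real)
  qed (auto elim!: dvdE)
  finally have "((\<lambda>n. \<Sum>d | d dvd n. a d * b (n div d) * of_nat n powr - s) has_sum (suminf A * suminf B)) {0<..}"
    by (rule has_sum_SigmaD) (auto intro!: has_sum_finite)
  hence "((\<lambda>n. \<Sum>d | d dvd n. a d * b (n div d) * of_nat n powr - s) has_sum (suminf A * suminf B)) UNIV"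
    by (rule has_sum_cong_neutral[THEN iffD1, rotated -1]) auto
  from has_sum_imp_sums[OF this] show ?thesis
    by (simp add: A_def B_def sum_distrib_right)
qed

section \<open>The von Mangoldt series and the logarithmic derivative of zeta\<close>

definition mangoldt_series :: "complex \<Rightarrow> complex" where
  "mangoldt_series s = (\<Sum>k. mangoldt k * of_nat k powr - s)"

lemma mangoldt_series_sums:
  assumes "Re s > 1"
  shows "(\<lambda>k. mangoldt k * of_nat k powr - s) sums mangoldt_series s"
proof -
  have "summable (\<lambda>k. norm (mangoldt k * of_nat k powr - s :: complex))"
    using summable_mangoldt_powr[OF assms] by (simp add: norm_mult norm_nat_powr)
  thus ?thesis
    unfolding mangoldt_series_def by (rule summable_sums[OF summable_norm_cancel])
qed

lemma zeta_holomorphic: "zeta holomorphic_on (- {1})"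
  using is_zeta_zeta by (simp add: is_zeta_def)

lemma has_field_derivative_zeta: "s \<noteq> 1 \<Longrightarrow> (zeta has_field_derivative deriv zeta s) (at s)"
  by (rule holomorphic_derivI[OF zeta_holomorphic]) auto

text \<open>The convention \<open>0 powr z = 0\<close> lets the series start at index 0, in line
  with the other Dirichlet series here.\<close>

lemma zeta_sums:
  assumes "Re s > 1"
  shows "(\<lambda>k. of_nat k powr - s) sums zeta s"
proof -
  have "(\<lambda>n. of_nat (Suc n) powr - s) sums zeta s"
    using is_zeta_zeta assms by (simp add: is_zeta_def powr_minus inverse_eq_divide)
  thus ?thesis by (subst (asm) sums_Suc_iff) simp
qed

text \<open>The convolution identity that sums \<open>mangoldt\<close> over the divisors of
  \<open>n\<close> to \<open>ln n\<close> identifies the product with minus the derivative. It is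
  kept as a product because non-vanishing of zeta is only derived from it afterwards.\<close>

lemma deriv_zeta:
  assumes "Re s > 1"
  shows "deriv zeta s = - mangoldt_series s * zeta s"
proof -
  have one: "summable (\<lambda>k. norm (1::complex) * real k powr - \<sigma>)" if "\<sigma> > 1" for \<sigma>
    using that by (simp add: summable_real_powr_iff)
  define g' where "g' = (\<Sum>k. - of_real (ln k) * 1 * of_nat k powr - s :: complex)"
  have g': "((\<lambda>s. \<Sum>k. 1 * of_nat k powr - s) has_field_derivative g') (at s)"
    "(\<lambda>k. - of_real (ln k) * 1 * of_nat k powr - s :: complex) sums g'"
    using dirichlet_series_deriv[of "\<lambda>_. 1", OF one assms] unfolding g'_def
    by (auto intro: summable_sums)
  have "(zeta has_field_derivative g') (at s)"
    using g'(1)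
    by (rule has_field_derivative_transform_within_open[where S = "{s. Re s > 1}"])
       (use assms zeta_sums in \<open>auto simp: open_halfspace_Re_gt sums_iff\<close>)
  hence dz: "deriv zeta s = g'" by (rule DERIV_imp_deriv)
  have "(\<lambda>n. (\<Sum>d | d dvd n. mangoldt d * 1) * of_nat n powr - s) sums
      (mangoldt_series s * (\<Sum>k. 1 * of_nat k powr - s))"
    unfolding mangoldt_series_def
    using assms one summable_mangoldt_powr by (intro dirichlet_series_product) auto
  also have "(\<lambda>n. (\<Sum>d | d dvd n. mangoldt d * 1) * of_nat n powr - s :: complex) =
      (\<lambda>n. - (- of_real (ln n) * 1 * of_nat n powr - s))"
  proof
    fix n
    show "(\<Sum>d | d dvd n. mangoldt d * 1) * of_nat n powr - s =
      - (- of_real (ln n) * 1 * of_nat n powr - s :: complex)"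
      by (cases "n = 0") (auto simp: mangoldt_sum)
  qed
  finally have "- g' = mangoldt_series s * zeta s"
    using sums_minus[OF g'(2)] zeta_sums[OF assms] by (auto simp: sums_iff)
  thus ?thesis using dz by (simp add: minus_equation_iff[of g'])
qed

text \<open>A single nonzero value is enough: it makes the constant in the exponential
  representation below nonzero, and thereby zeta nonzero on the whole half-plane.\<close>

lemma zeta_2_nonzero: "zeta 2 \<noteq> 0"
proof -
  have "(\<lambda>k. complex_of_real (real k powr -2)) sums zeta 2"
  proof -
    have "of_nat k powr - 2 = complex_of_real (real k powr -2)" for k
      using powr_of_real[of "real k" "-2"] by simp
    thus ?thesis using zeta_sums[of 2] by simp
  qed
  moreover have "(\<lambda>k. complex_of_real (real k powr -2)) sums of_real (\<Sum>k. real k powr -2)"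
    by (intro sums_of_real summable_sums) (simp add: summable_real_powr_iff)
  ultimately have "zeta 2 = of_real (\<Sum>k. real k powr -2)"
    by (rule sums_unique2)
  moreover have "(\<Sum>k. real k powr -2) > 0"
    by (rule suminf_pos2[of _ 1]) (auto simp: summable_real_powr_iff)
  ultimately show ?thesis by simp
qed

text \<open>
  An antiderivative of the von Mangoldt series replaces the logarithm of zeta, so that no Euler
  product is needed.
\<close>

lemma zeta_exp_primitive:
  obtains A c where "c \<noteq> 0"
    "\<And>s. Re s > 1 \<Longrightarrow> (A has_field_derivative mangoldt_series s) (at s)"
    "\<And>s. Re s > 1 \<Longrightarrow> zeta s = c * exp (- A s)"
proof -
  let ?S = "{s::complex. Re s > 1}"
  have opn: "open ?S" by (rule open_halfspace_Re_gt)
  have cvx: "convex ?S" by (rule convex_halfspace_Re_gt)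
  have sm: "summable (\<lambda>k. norm (mangoldt k :: complex) * real k powr - \<sigma>)" if "\<sigma> > 1" for \<sigma>
    using summable_mangoldt_powr[OF that] by simp
  have "\<exists>D'. (mangoldt_series has_field_derivative D') (at s)" if "Re s > 1" for s
    using dirichlet_series_deriv(1)[of mangoldt, OF sm that] unfolding mangoldt_series_def[abs_def] by blast
  hence "mangoldt_series holomorphic_on ?S"
    using opn by (auto simp: holomorphic_on_open)
  then obtain A where "\<And>s. s \<in> ?S \<Longrightarrow> (A has_field_derivative mangoldt_series s) (at s within ?S)"
    by (rule holomorphic_convex_primitive'[OF cvx opn]) (rule that)
  hence A: "\<And>s. Re s > 1 \<Longrightarrow> (A has_field_derivative mangoldt_series s) (at s)"
    by (simp add: at_within_open[OF _ opn])
  have "\<exists>c. \<forall>s\<in>?S. zeta s * exp (A s) = c"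
  proof (rule has_field_derivative_zero_constant[OF cvx])
    fix s assume s: "s \<in> ?S"
    hence "s \<noteq> 1" by auto
    hence "((\<lambda>s. zeta s * exp (A s)) has_field_derivative
            deriv zeta s * exp (A s) + zeta s * (exp (A s) * mangoldt_series s)) (at s)"
      using s A by (auto intro!: derivative_eq_intros has_field_derivative_zeta)
    also have "deriv zeta s * exp (A s) + zeta s * (exp (A s) * mangoldt_series s) = 0"
      using s by (simp add: deriv_zeta)
    finally show "((\<lambda>s. zeta s * exp (A s)) has_field_derivative 0) (at s within ?S)"
      by (rule has_field_derivative_at_within)
  qed
  then obtain c where c: "\<And>s. Re s > 1 \<Longrightarrow> zeta s * exp (A s) = c" by auto
  have "c \<noteq> 0" using c[of 2] zeta_2_nonzero by auto
  moreover have "zeta s = c * exp (- A s)" if "Re s > 1" for s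
    using c[OF that] by (auto simp: exp_minus field_simps)
  ultimately show ?thesis using A by (intro that)
qed

lemma zeta_nonzero_Re_gt_1: "Re s > 1 \<Longrightarrow> zeta s \<noteq> 0"
  by (rule zeta_exp_primitive) (simp only: mult_eq_0_iff exp_not_eq_zero simp_thms)

lemma mangoldt_series_eq: "Re s > 1 \<Longrightarrow> mangoldt_series s = - (deriv zeta s / zeta s)"
  using zeta_nonzero_Re_gt_1[of s] by (simp add: deriv_zeta)

lemma nat_powr_cis:
  assumes "k > 0"
  shows "of_nat k powr - (of_real \<sigma> + \<i> * of_real t) = of_real (real k powr - \<sigma>) * cis (- t * ln (real k))"
proof -
  have exp_eq: "exp (complex_of_real a + \<i> * of_real b) = of_real (exp a) * cis b" for a b
    by (simp add: exp_add cis_conv_exp exp_of_real)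
  have "of_nat k powr - (of_real \<sigma> + \<i> * of_real t) = exp (of_real (- \<sigma> * ln (real k)) + \<i> * of_real (- t * ln (real k)))"
    using assms by (simp add: powr_def Ln_of_nat algebra_simps)
  also have "\<dots> = of_real (real k powr - \<sigma>) * cis (- t * ln (real k))"
    using assms unfolding exp_eq by (simp add: powr_def)
  finally show ?thesis .
qed

section \<open>Non-vanishing on the line of real part 1\<close>

text \<open>Comparison of the sum with the telescoping differences of
  \<open>k powr (1 - \<sigma>)\<close>. It says that zeta grows at most like a simple pole when 1 is
  approached from the right, which is all that the 3-4-1 argument asks of the pole.\<close>

lemma zeta_real_le:
  fixes \<sigma> :: real
  assumes "\<sigma> > 1"
  shows "(\<sigma> - 1) * norm (zeta (of_real \<sigma>)) \<le> \<sigma>"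
proof -
  define f where "f = (\<lambda>k. real (Suc k) powr (1 - \<sigma>))"
  have le: "(\<sigma> - 1) * real (Suc (Suc k)) powr - \<sigma> \<le> f k - f (Suc k)" for k
  proof -
    have "\<exists>z>real (Suc k). z < real (Suc (Suc k)) \<and> real (Suc (Suc k)) powr (1 - \<sigma>) - real (Suc k) powr (1 - \<sigma>) =
            (real (Suc (Suc k)) - real (Suc k)) * ((1 - \<sigma>) * z powr (1 - \<sigma> - 1))"
      by (rule MVT2) (simp, rule has_real_derivative_powr, simp)
    then obtain z where z: "z > real (Suc k)" "z < real (Suc (Suc k))" 
      "f (Suc k) - f k = (1 - \<sigma>) * z powr (- \<sigma>)" by (auto simp: f_def)
    have "real (Suc (Suc k)) powr - \<sigma> \<le> z powr - \<sigma>"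
      using z assms by (intro powr_mono2') auto
    hence "(\<sigma> - 1) * real (Suc (Suc k)) powr - \<sigma> \<le> (\<sigma> - 1) * z powr - \<sigma>"
      using assms by (intro mult_left_mono) auto
    thus ?thesis using z(3) by (simp add: algebra_simps)
  qed
  have "f \<longlonglongrightarrow> 0"
    unfolding f_def using assms
    by (intro tendsto_neg_powr filterlim_compose[OF filterlim_real_sequentially filterlim_Suc]) auto
  from telescope_sums'[OF this] have tel: "(\<lambda>k. f k - f (Suc k)) sums 1"
    by (simp add: f_def)
  have sm: "summable (\<lambda>k. real k powr - \<sigma>)" using assms by (simp add: summable_real_powr_iff)
  hence sm1: "summable (\<lambda>k. real (Suc (Suc k)) powr - \<sigma>)"
    by (subst summable_Suc_iff[of "\<lambda>k. real (Suc k) powr - \<sigma>"], subst summable_Suc_iff)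
  have "norm (zeta (of_real \<sigma>)) \<le> (\<Sum>k. real k powr - \<sigma>)"
  proof -
    have "zeta (of_real \<sigma>) = (\<Sum>k. of_nat k powr - of_real \<sigma>)"
      using zeta_sums[of "of_real \<sigma>"] assms by (simp add: sums_iff)
    also have "norm \<dots> \<le> (\<Sum>k. norm (of_nat k powr - of_real \<sigma> :: complex))"
      using sm by (intro summable_norm) (simp add: norm_nat_powr)
    finally show ?thesis by (simp add: norm_nat_powr)
  qed
  also have "(\<Sum>k. real k powr - \<sigma>) = (\<Sum>k. real (Suc (Suc k)) powr - \<sigma>) + 1"
    using suminf_split_initial_segment[OF sm, of 2] by (simp add: numeral_2_eq_2)
  finally have "(\<sigma> - 1) * norm (zeta (of_real \<sigma>)) \<le> (\<sigma> - 1) * ((\<Sum>k. real (Suc (Suc k)) powr - \<sigma>) + 1)"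
    using assms by (intro mult_left_mono) auto
  also have "\<dots> = (\<Sum>k. (\<sigma> - 1) * real (Suc (Suc k)) powr - \<sigma>) + (\<sigma> - 1)"
    using sm1 by (subst suminf_mult) (auto simp: algebra_simps)
  also have "(\<Sum>k. (\<sigma> - 1) * real (Suc (Suc k)) powr - \<sigma>) \<le> (\<Sum>k. f k - f (Suc k))"
    using sm1 tel by (intro suminf_le le summable_mult) (auto simp: sums_iff)
  also have "\<dots> = 1" using tel by (simp add: sums_iff)
  finally show ?thesis by simp
qed

lemma three_four_one: "3 + 4 * cos x + cos (2 * x) \<ge> (0::real)"
proof -
  have "3 + 4 * cos x + cos (2 * x) = 2 * (1 + cos x)^2"
    using cos_double_cos[of x] by (simp add: power2_eq_square algebra_simps)
  thus ?thesis by simp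
qed

lemma mangoldt_series_341:
  assumes "\<sigma> > 1"
  shows "3 * Re (mangoldt_series (of_real \<sigma>)) + 4 * Re (mangoldt_series (of_real \<sigma> + \<i> * of_real t))
           + Re (mangoldt_series (of_real \<sigma> + \<i> * of_real (2 * t))) \<ge> 0"
proof -
  define u where "u = (\<lambda>t k. Re (mangoldt k * of_nat k powr - (of_real \<sigma> + \<i> * of_real t)))"
  have u: "u t sums Re (mangoldt_series (of_real \<sigma> + \<i> * of_real t))" for t
    unfolding u_def using assms by (intro sums_Re mangoldt_series_sums) auto
  have "(\<lambda>k. 3 * u 0 k + 4 * u t k + u (2 * t) k) sums
     (3 * Re (mangoldt_series (of_real \<sigma> + \<i> * of_real 0)) + 4 * Re (mangoldt_series (of_real \<sigma> + \<i> * of_real t))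
           + Re (mangoldt_series (of_real \<sigma> + \<i> * of_real (2 * t))))"
    by (intro sums_add sums_mult u)
  moreover have "3 * u 0 k + 4 * u t k + u (2 * t) k \<ge> 0" for k
  proof (cases "k = 0")
    case False
    hence u_eq: "u t k = mangoldt k * real k powr - \<sigma> * cos (t * ln (real k))" for t
      unfolding u_def using nat_powr_cis[of k \<sigma> t] by simp
    have "3 * u 0 k + 4 * u t k + u (2 * t) k =
      mangoldt k * real k powr - \<sigma> * (3 + 4 * cos (t * ln (real k)) + cos (2 * (t * ln (real k))))"
      unfolding u_eq by (simp add: algebra_simps)
    thus ?thesis using three_four_one by (auto intro!: mult_nonneg_nonneg mangoldt_nonneg)
  qed (simp add: u_def)
  ultimately have "3 * Re (mangoldt_series (of_real \<sigma> + \<i> * of_real 0)) + 4 * Re (mangoldt_series (of_real \<sigma> + \<i> * of_real t))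
           + Re (mangoldt_series (of_real \<sigma> + \<i> * of_real (2 * t))) \<ge> 0"
    by (rule sums_le[OF _ sums_zero, rotated])
  thus ?thesis by simp
qed

text \<open>The 3-4-1 inequality holds for the real part of the derivative of the exponent
  \<open>A\<close>, so the combination \<open>G\<close> increases with \<sigma>. As the product of
  absolute values is \<open>norm c ^ 8 * exp (- G \<sigma>)\<close>, its value at 2 is a lower
  bound; any positive bound uniform in \<sigma> will do.\<close>

lemma zeta_341_lower_bound:
  fixes t :: real
  obtains K where "K > 0" "\<And>\<sigma>. 1 < \<sigma> \<Longrightarrow> \<sigma> \<le> 2 \<Longrightarrow>
    K \<le> norm (zeta (of_real \<sigma>)) ^ 3 * norm (zeta (of_real \<sigma> + \<i> * of_real t)) ^ 4 *
        norm (zeta (of_real \<sigma> + \<i> * of_real (2 * t)))"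
proof -
  obtain A c where A: "c \<noteq> 0"
    "\<And>s. Re s > 1 \<Longrightarrow> (A has_field_derivative mangoldt_series s) (at s)"
    "\<And>s. Re s > 1 \<Longrightarrow> zeta s = c * exp (- A s)"
    by (rule zeta_exp_primitive) (rule that)
  define h where "h = (\<lambda>u \<sigma>. Re (A (of_real \<sigma> + \<i> * of_real u)))"
  have h: "(h u has_real_derivative Re (mangoldt_series (of_real \<sigma> + \<i> * of_real u))) (at \<sigma>)"
    if "\<sigma> > 1" for u \<sigma>
  proof -
    have "((\<lambda>z. A (z + \<i> * of_real u)) has_field_derivative mangoldt_series (of_real \<sigma> + \<i> * of_real u) * 1)
            (at (of_real \<sigma>))"
      by (rule DERIV_chain2[OF A(2)]) (use that in \<open>auto intro!: derivative_eq_intros\<close>)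
    hence "((\<lambda>x. A (of_real x + \<i> * of_real u)) has_vector_derivative mangoldt_series (of_real \<sigma> + \<i> * of_real u)) (at \<sigma>)"
      using has_vector_derivative_real_field by fastforce
    thus ?thesis
      unfolding h_def has_real_derivative_iff_has_vector_derivative
      by (rule bounded_linear.has_vector_derivative[OF bounded_linear_Re])
  qed
  define G where "G = (\<lambda>\<sigma>. 3 * h 0 \<sigma> + 4 * h t \<sigma> + h (2 * t) \<sigma>)"
  have G: "G \<sigma> \<le> G 2" if "1 < \<sigma>" "\<sigma> \<le> 2" for \<sigma>
  proof (rule DERIV_nonneg_imp_nondecreasing[OF that(2)])
    fix x assume "\<sigma> \<le> x" "x \<le> 2"
    hence x: "x > 1" using that by simp
    have "(G has_real_derivative (3 * Re (mangoldt_series (of_real x + \<i> * of_real 0)) + 4 * Re (mangoldt_series (of_real x + \<i> * of_real t))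
           + Re (mangoldt_series (of_real x + \<i> * of_real (2 * t))))) (at x)"
      unfolding G_def using x by (intro DERIV_add DERIV_cmult h)
    thus "\<exists>y. DERIV G x :> y \<and> y \<ge> 0"
      using mangoldt_series_341[OF x, of t] by auto
  qed
  have nz: "norm (zeta (of_real \<sigma> + \<i> * of_real u)) = norm c * exp (- h u \<sigma>)" if "\<sigma> > 1" for \<sigma> u
    using A(3)[of "of_real \<sigma> + \<i> * of_real u"] that by (simp add: norm_mult h_def)
  show ?thesis
  proof (rule that[of "norm c ^ 8 * exp (- G 2)"])
    show "norm c ^ 8 * exp (- G 2) > 0" using A(1) by simp
    fix \<sigma> :: real assume s: "1 < \<sigma>" "\<sigma> \<le> 2"
    have "norm c ^ 8 * exp (- G 2) \<le> norm c ^ 8 * exp (- G \<sigma>)"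
      using G[OF s] by (intro mult_left_mono) auto
    also have "exp (- G \<sigma>) = exp (- h 0 \<sigma>) ^ 3 * exp (- h t \<sigma>) ^ 4 * exp (- h (2 * t) \<sigma>)"
      by (simp add: G_def exp_of_nat_mult[symmetric] exp_add[symmetric] algebra_simps)
    also have "norm c ^ 8 * \<dots> = (norm c * exp (- h 0 \<sigma>)) ^ 3 * (norm c * exp (- h t \<sigma>)) ^ 4 * (norm c * exp (- h (2 * t) \<sigma>))"
    proof -
      have "norm c ^ 8 = norm c ^ 3 * norm c ^ 4 * norm c" by (simp add: power_numeral_reduce)
      thus ?thesis by (simp only: power_mult_distrib mult_ac)
    qed
    finally show "norm c ^ 8 * exp (- G 2) \<le> norm (zeta (of_real \<sigma>)) ^ 3 * norm (zeta (of_real \<sigma> + \<i> * of_real t)) ^ 4 *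
        norm (zeta (of_real \<sigma> + \<i> * of_real (2 * t)))"
      using nz[OF s(1), of 0] nz[OF s(1), of t] nz[OF s(1), of "2 * t"] by simp
  qed
qed

text \<open>A zero would enter the 3-4-1 product with multiplicity at least four, the pole with
  multiplicity three, while zeta stays bounded near \<open>1 + 2 * \<i> * t\<close>. The product
  would then tend to 0.\<close>

lemma zeta_nonzero_Re_eq_1:
  assumes "t \<noteq> 0"
  shows "zeta (1 + \<i> * of_real t) \<noteq> 0"
proof
  assume zero: "zeta (1 + \<i> * of_real t) = 0"
  obtain K where K: "K > 0" "\<And>\<sigma>. 1 < \<sigma> \<Longrightarrow> \<sigma> \<le> 2 \<Longrightarrow>
    K \<le> norm (zeta (of_real \<sigma>)) ^ 3 * norm (zeta (of_real \<sigma> + \<i> * of_real t)) ^ 4 *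
        norm (zeta (of_real \<sigma> + \<i> * of_real (2 * t)))"
    by (rule zeta_341_lower_bound) (rule that)
  have ne: "1 + \<i> * of_real t \<noteq> 1" "1 + \<i> * of_real (2 * t) \<noteq> 1" using assms by auto
  define q where "q = (\<lambda>\<sigma>. zeta (of_real \<sigma> + \<i> * of_real t) / of_real (\<sigma> - 1))"
  have "((\<lambda>z. zeta (z + \<i> * of_real t)) has_field_derivative deriv zeta (1 + \<i> * of_real t) * 1) (at (of_real 1))"
    by (rule DERIV_chain2) (use has_field_derivative_zeta[OF ne(1)] in \<open>auto intro!: derivative_eq_intros\<close>)
  hence "((\<lambda>y. (zeta (y + \<i> * of_real t) - zeta (of_real 1 + \<i> * of_real t)) / (y - of_real 1))
           \<longlongrightarrow> deriv zeta (1 + \<i> * of_real t)) (at (of_real 1))"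
    by (simp add: has_field_derivative_iff)
  moreover have "filterlim complex_of_real (at (of_real 1)) (at 1)"
    by (auto simp: filterlim_at eventually_at_filter intro!: tendsto_eq_intros)
  ultimately have "((\<lambda>x. (zeta (of_real x + \<i> * of_real t) - zeta (of_real 1 + \<i> * of_real t)) / (of_real x - of_real 1))
           \<longlongrightarrow> deriv zeta (1 + \<i> * of_real t)) (at 1)"
    by (rule filterlim_compose)
  hence q: "(q \<longlongrightarrow> deriv zeta (1 + \<i> * of_real t)) (at 1)"
    using zero by (simp add: q_def[abs_def])
  have "((\<lambda>\<sigma>. zeta (of_real \<sigma> + \<i> * of_real (2 * t))) \<longlongrightarrow> zeta (of_real 1 + \<i> * of_real (2 * t))) (at 1)"
  proof (rule isCont_tendsto_compose[where g = zeta])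
    show "isCont zeta (of_real 1 + \<i> * of_real (2 * t))"
      using has_field_derivative_zeta[OF ne(2)] by (auto intro: DERIV_isCont)
  qed (intro tendsto_intros)
  hence "((\<lambda>\<sigma>. \<sigma> ^ 3 * norm (q \<sigma>) ^ 4 * norm (zeta (of_real \<sigma> + \<i> * of_real (2 * t))) * (\<sigma> - 1)) \<longlongrightarrow>
     1 ^ 3 * norm (deriv zeta (1 + \<i> * of_real t)) ^ 4 * norm (zeta (of_real 1 + \<i> * of_real (2 * t))) * (1 - 1)) (at 1)"
    using q by (intro tendsto_intros)
  hence lim: "((\<lambda>\<sigma>. \<sigma> ^ 3 * norm (q \<sigma>) ^ 4 * norm (zeta (of_real \<sigma> + \<i> * of_real (2 * t))) * (\<sigma> - 1)) \<longlongrightarrow> 0) (at 1)"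
    by (simp only: diff_self mult_zero_right)
  have "((\<lambda>\<sigma>. \<sigma> ^ 3 * norm (q \<sigma>) ^ 4 * norm (zeta (of_real \<sigma> + \<i> * of_real (2 * t))) * (\<sigma> - 1)) \<longlongrightarrow> 0) (at_right 1)"
    by (rule tendsto_mono[OF at_le lim]) simp
  moreover have "eventually (\<lambda>\<sigma>. \<sigma> ^ 3 * norm (q \<sigma>) ^ 4 * norm (zeta (of_real \<sigma> + \<i> * of_real (2 * t))) * (\<sigma> - 1) \<ge> K) (at_right 1)"
    using eventually_at_right_real[of 1 "2::real", simplified]
  proof eventually_elim
    case (elim \<sigma>)
    define x where "x = norm (zeta (of_real \<sigma>))"
    define z where "z = norm (zeta (of_real \<sigma> + \<i> * of_real (2 * t)))"
    have y: "norm (zeta (of_real \<sigma> + \<i> * of_real t)) = norm (q \<sigma>) * (\<sigma> - 1)"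
    proof -
      have "norm (complex_of_real (\<sigma> - 1)) = \<sigma> - 1"
        using elim unfolding norm_of_real by simp
      thus ?thesis using elim by (simp add: q_def norm_divide del: of_real_diff)
    qed
    have "K \<le> x ^ 3 * (norm (q \<sigma>) * (\<sigma> - 1)) ^ 4 * z"
      using K(2)[of \<sigma>] elim by (simp add: x_def z_def y)
    \<comment> \<open>Three of the four factors \<open>\<sigma> - 1\<close> cancel the pole; the
      remaining one forces the limit 0.\<close>
    also have "\<dots> = ((\<sigma> - 1) * x) ^ 3 * (norm (q \<sigma>) ^ 4 * z * (\<sigma> - 1))"
    proof -
      have "(\<sigma> - 1) ^ 4 = (\<sigma> - 1) ^ 3 * (\<sigma> - 1)" by (simp add: power_numeral_reduce)
      thus ?thesis by (simp only: power_mult_distrib mult_ac)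
    qed
    also have "\<dots> \<le> \<sigma> ^ 3 * (norm (q \<sigma>) ^ 4 * z * (\<sigma> - 1))"
      using elim zeta_real_le[of \<sigma>]
      by (intro mult_right_mono power_mono) (auto simp: x_def z_def)
    finally show ?case by (simp add: z_def mult_ac)
  qed
  ultimately have "K \<le> 0"
    by (rule tendsto_lowerbound) simp
  thus False using K(1) by simp
qed

section \<open>Sums of the von Mangoldt function, divisor counts and spacing\<close>

lemma ln_fact_ge: "ln (fact n) \<ge> real n * ln (real n) - real n"
proof (induction n)
  case (Suc n)
  show ?case
  proof (cases "n = 0")
    case False
    have "real n * (ln (real (Suc n)) - ln (real n)) = real n * ln (1 + 1 / real n)"
    proof -
      have "1 + 1 / real n = real (Suc n) / real n" using False by (simp add: field_simps)
      thus ?thesis using False by (simp add: ln_div del: of_nat_Suc)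
    qed
    also have "\<dots> \<le> real n * (1 / real n)"
      using False by (intro mult_left_mono ln_add_one_self_le_self) auto
    finally have "real n * ln (real (Suc n)) - real n * ln (real n) \<le> 1"
      using False by (simp add: algebra_simps)
    moreover have "ln (fact (Suc n) :: real) = ln (real (Suc n)) + ln (fact n)"
      by (simp add: ln_mult del: of_nat_Suc)
    ultimately show ?thesis using Suc.IH by (simp add: algebra_simps)
  qed simp
qed simp

text \<open>The lower half of Mertens' first theorem, by Chebyshev's double count: writing each
  \<open>ln n\<close> in \<open>ln (fact N)\<close> as a divisor sum, \<open>mangoldt d\<close>
  occurs once for every multiple of \<open>d\<close> up to \<open>N\<close>, hence at most
  \<open>N / d\<close> times.\<close>

lemma mangoldt_sum_ge:
  assumes "N \<ge> 1"
  shows "(\<Sum>k=1..N. mangoldt k / real k) \<ge> ln (real N) - 1"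
proof -
  have "real N * (ln (real N) - 1) \<le> ln (fact N)"
    using ln_fact_ge[of N] by (simp add: algebra_simps)
  also have "fact N = (\<Prod>n=1..N. real n)"
    by (simp add: fact_prod)
  also have "ln \<dots> = (\<Sum>n=1..N. ln (real n))"
    by (intro ln_prod) auto
  also have "\<dots> = (\<Sum>n=1..N. \<Sum>d=1..N. if d dvd n then mangoldt d else 0)"
  proof (intro sum.cong refl)
    fix n assume n: "n \<in> {1..N}"
    have "ln (real n) = (\<Sum>d | d dvd n. mangoldt d)"
      using n by (subst mangoldt_sum) auto
    also have "\<dots> = (\<Sum>d\<in>{1..N} \<inter> {d. d dvd n}. mangoldt d)"
    proof (rule sum.cong)
      show "{d. d dvd n} = {1..N} \<inter> {d. d dvd n}"
        using n dvd_imp_le[of _ n] by (force simp: Suc_le_eq intro!: Nat.gr0I)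
    qed auto
    finally show "ln (real n) = (\<Sum>d=1..N. if d dvd n then mangoldt d else 0)"
      by (simp add: sum.inter_restrict)
  qed
  also have "\<dots> = (\<Sum>d=1..N. \<Sum>n=1..N. if d dvd n then mangoldt d else 0)"
    by (rule sum.swap)
  also have "\<dots> \<le> (\<Sum>d=1..N. real N * (mangoldt d / real d))"
  proof (rule sum_mono)
    fix d assume d: "d \<in> {1..N}"
    have "card ({1..N} \<inter> {n. d dvd n}) \<le> card ((\<lambda>i. d * i) ` {1..N div d})"
    proof (rule card_mono)
      show "{1..N} \<inter> {n. d dvd n} \<subseteq> (\<lambda>i. d * i) ` {1..N div d}"
        using d by (auto elim!: dvdE intro!: imageI simp: less_eq_div_iff_mult_less_eq mult_ac Suc_le_eq)
    qed auto
    also have "\<dots> \<le> card {1..N div d}" by (intro card_image_le) auto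
    finally have "real (card ({1..N} \<inter> {n. d dvd n})) \<le> real (N div d)" by simp
    also have "\<dots> \<le> real N / real d" by (rule of_nat_div_le_of_nat)
    finally have "real (card ({1..N} \<inter> {n. d dvd n})) * mangoldt d \<le> real N / real d * mangoldt d"
      by (intro mult_right_mono mangoldt_nonneg)
    thus "(\<Sum>n=1..N. if d dvd n then mangoldt d else 0) \<le> real N * (mangoldt d / real d)"
      by (simp add: sum.If_cases)
  qed
  also have "\<dots> = real N * (\<Sum>d=1..N. mangoldt d / real d)"
    by (simp add: sum_distrib_left)
  finally show ?thesis using assms by simp
qed

text \<open>Only powers \<open>p ^ (j + 2)\<close> contribute, and for each base they form a
  geometric series of ratio at most 1/2. The bound is uniform in the finite set \<open>F\<close>,
  because it serves both the integers up to \<open>y\<close> and the divisors of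
  \<open>Q\<close>.\<close>

lemma mangoldt_nonprime_sum_le:
  obtains B :: real where "B \<ge> 0"
    "\<And>F. finite F \<Longrightarrow> (\<And>k. k \<in> F \<Longrightarrow> \<not> prime k) \<Longrightarrow> (\<Sum>k\<in>F. mangoldt k / real k) \<le> B"
proof -
  have sm: "summable (\<lambda>k. 2 * (ln (real k) * real k powr -2))"
    by (intro summable_mult summable_ln_powr) auto
  define B where "B = (\<Sum>k. 2 * (ln (real k) * real k powr -2))"
  have nn: "2 * (ln (real k) * real k powr -2) \<ge> 0" for k
    by (cases "k = 0") auto
  show ?thesis
  proof (rule that[of B])
    show "B \<ge> 0" unfolding B_def by (intro suminf_nonneg sm nn)
    fix F :: "nat set" assume F: "finite F" "\<And>k. k \<in> F \<Longrightarrow> \<not> prime k"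
    define M where "M = Max (insert 0 F)"
    have M: "k \<le> M" if "k \<in> F" for k using F that by (simp add: M_def)
    define g :: "nat \<times> nat \<Rightarrow> real" where "g = (\<lambda>(p, j). ln (real p) / real p ^ (j + 2))"
    have "(\<Sum>k\<in>F. mangoldt k / real k) = (\<Sum>k\<in>{k\<in>F. primepow k}. mangoldt k / real k)"
      using F by (intro sum.mono_neutral_right) (auto simp: mangoldt_def)
    \<comment> \<open>The pairs run over all bases \<open>p \<ge> 2\<close>, prime or not;
      overcounting is harmless since the terms are nonnegative and the series still
      converges.\<close>
    also have "\<dots> \<le> (\<Sum>z\<in>{2..M} \<times> {..M}. g z)"
    proof (rule sum_le_included[where i = "\<lambda>(p, j). p ^ (j + 2)"])
      show "\<forall>k\<in>{k\<in>F. primepow k}. \<exists>z\<in>{2..M} \<times> {..M}. (case z of (p, j) \<Rightarrow> p ^ (j + 2)) = k \<and> mangoldt k / real k \<le> g z"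
      proof
        fix k assume k: "k \<in> {k\<in>F. primepow k}"
        then obtain p i where p: "prime p" "i > 0" "k = p ^ i" by (auto simp: primepow_def)
        have "i \<noteq> 1" using F(2)[of k] k p by auto
        then obtain j where j: "i = j + 2"
          using p(2) by (intro that[of "i - 2"]) simp
        have p2: "p \<ge> 2" using p(1) by (rule prime_ge_2_nat)
        \<comment> \<open>The exponent is smaller than the prime power itself, so the index box
          bounded by \<open>M\<close> contains it.\<close>
        have "i < 2 ^ i" by (rule less_exp)
        also have "\<dots> \<le> p ^ i" using p2 by (rule power_mono) simp
        finally have "i < k" using p by simp
        moreover have "p \<le> k" using p p2 by (simp add: self_le_power)
        ultimately have "(p, j) \<in> {2..M} \<times> {..M}" using M[of k] k j p2 by auto
        moreover have "mangoldt k / real k \<le> g (p, j)"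
        proof -
          have mk: "mangoldt k = ln (real p)" unfolding p(3) using p(1,2) by (simp add: mangoldt_primepow)
          have rk: "real k = real p ^ (j + 2)" by (simp add: p(3) j)
          show ?thesis unfolding mk rk g_def by simp
        qed
        ultimately show "\<exists>z\<in>{2..M} \<times> {..M}. (case z of (p, j) \<Rightarrow> p ^ (j + 2)) = k \<and> mangoldt k / real k \<le> g z"
          using p j by (intro bexI[of _ "(p, j)"]) auto
      qed
    qed (use F in \<open>auto simp: g_def intro!: divide_nonneg_nonneg\<close>)
    also have "\<dots> = (\<Sum>p=2..M. \<Sum>j\<le>M. g (p, j))"
      by (simp add: sum.cartesian_product)
    also have "\<dots> \<le> (\<Sum>p=2..M. 2 * (ln (real p) * real p powr -2))"
    proof (rule sum_mono)
      fix p assume "p \<in> {2..M}"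
      hence p: "p \<ge> 2" by simp
      have "(\<Sum>j\<le>M. g (p, j)) = ln (real p) / real p ^ 2 * (\<Sum>j\<le>M. (1 / real p) ^ j)"
        unfolding g_def sum_distrib_left using p
        by (intro sum.cong) (auto simp: power_add power2_eq_square field_simps)
      also have "\<dots> \<le> ln (real p) / real p ^ 2 * 2"
      proof (rule mult_left_mono)
        have "(\<Sum>j\<le>M. (1 / real p) ^ j) \<le> (\<Sum>j. (1 / real p) ^ j)"
          using p by (intro sum_le_suminf summable_geometric) auto
        also have "\<dots> = 1 / (1 - 1 / real p)"
          using p by (intro suminf_geometric) auto
        also have "\<dots> \<le> 2"
          using p by (simp add: field_simps)
        finally show "(\<Sum>j\<le>M. (1 / real p) ^ j) \<le> 2" .
      qed (use p in auto)
      also have "real p ^ 2 = real p powr 2" using p by simp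
      finally show "(\<Sum>j\<le>M. g (p, j)) \<le> 2 * (ln (real p) * real p powr -2)"
        unfolding powr_minus_divide by (simp add: mult.commute)
    qed
    also have "\<dots> \<le> B"
      unfolding B_def by (intro sum_le_suminf sm nn) auto
    finally show "(\<Sum>k\<in>F. mangoldt k / real k) \<le> B" .
  qed
qed

text \<open>
  A divisor \<open>n\<close> of \<open>Q\<close> with \<open>n * p\<close> not dividing \<open>Q\<close> is a multiple of \<open>p ^ L\<close>, and the quotients
  \<open>n div p ^ j\<close> with \<open>j \<le> L\<close> are distinct divisors for distinct pairs \<open>(j, n)\<close>.
\<close>

lemma card_dvd_mult_prime_ge:
  fixes p L Q :: nat
  assumes p: "prime p" and L: "p ^ L dvd Q" and Q: "Q > 0"
  shows "L * card {n. n dvd Q} \<le> (L + 1) * card {n. n * p dvd Q}"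
proof -
  define D where "D = {n. n dvd Q}"
  define E where "E = {n. n * p dvd Q}"
  have fin: "finite D" using Q by (simp add: D_def)
  have ED: "E \<subseteq> D" by (auto simp: D_def E_def intro: dvd_mult_left)
  have p0: "p > 0" using p by (rule prime_gt_0_nat)
  have dvd: "p ^ L dvd n" if "n \<in> D - E" for n
  proof -
    obtain m where m: "Q = n * m" using \<open>n \<in> D - E\<close> by (auto simp: D_def)
    have "\<not> p dvd m" using \<open>n \<in> D - E\<close> m by (auto simp: E_def)
    hence "coprime (p ^ L) m" using p by (simp add: prime_imp_coprime)
    thus ?thesis using L m by (simp add: coprime_dvd_mult_left_iff)
  qed
  have "card ({..L} \<times> (D - E)) \<le> card D"
  proof (rule card_inj_on_le[of "\<lambda>(j, n). n div p ^ j"])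
    have div: "p ^ j dvd n" if "j \<le> L" "n \<in> D - E" for j n
      using dvd[OF that(2)] le_imp_power_dvd[OF that(1), of p] by (rule dvd_trans[rotated])
    \<comment> \<open>With equal quotients and \<open>j < j'\<close>, the divisor \<open>n'\<close>
      of \<open>Q\<close> is a multiple of \<open>n * p\<close>, which would put \<open>n\<close>
      into \<open>E\<close>.\<close>
    have le: "j' \<le> j" if "j' \<le> L" "n' \<in> D - E" "j \<le> L" "n \<in> D - E" "n div p ^ j = n' div p ^ j'" for j j' n n'
    proof (rule ccontr)
      assume "\<not> j' \<le> j"
      then obtain i where i: "j' = j + Suc i" using less_imp_Suc_add[of j j'] by auto
      define u where "u = n div p ^ j"
      have "n = u * p ^ j"
        using div[OF that(3,4)] by (simp add: u_def)
      moreover have "n' = u * p ^ j'"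
        unfolding u_def that(5) using div[OF that(1,2)] by simp
      ultimately have "n' = n * p * p ^ i" by (simp add: i power_add)
      hence "n * p dvd n'" by simp
      moreover have "n' dvd Q" using that by (simp add: D_def)
      ultimately have "n \<in> E" by (auto simp: E_def intro: dvd_trans)
      thus False using that by simp
    qed
    show "inj_on (\<lambda>(j, n). n div p ^ j) ({..L} \<times> (D - E))"
    proof (rule inj_onI)
      fix z z' assume z: "z \<in> {..L} \<times> (D - E)" "z' \<in> {..L} \<times> (D - E)"
        "(case z of (j, n) \<Rightarrow> n div p ^ j) = (case z' of (j, n) \<Rightarrow> n div p ^ j)"
      obtain j n j' n' where zz: "z = (j, n)" "z' = (j', n')" by fastforce
      have *: "j \<in> {..L}" "j' \<in> {..L}" "n \<in> D" "n \<notin> E" "n' \<in> D" "n' \<notin> E" "n div p ^ j = n' div p ^ j'"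
        using z by (auto simp: zz)
      have "j = j'"
        using le[of j n j' n'] le[of j' n' j n] * by auto
      moreover have "n = (n div p ^ j) * p ^ j" "n' = (n' div p ^ j') * p ^ j'"
      proof -
        have "p ^ j dvd n" "p ^ j' dvd n'" using div[of j n] div[of j' n'] *(1-6) by auto
        thus "n = (n div p ^ j) * p ^ j" "n' = (n' div p ^ j') * p ^ j'" by simp_all
      qed
      ultimately show "z = z'" using * zz by metis
    qed
    show "(\<lambda>(j, n). n div p ^ j) ` ({..L} \<times> (D - E)) \<subseteq> D"
    proof (rule image_subsetI)
      fix z assume "z \<in> {..L} \<times> (D - E)"
      then obtain j n where z: "z = (j, n)" "j \<in> {..L}" "n \<in> D" "n \<notin> E" by auto
      hence "n = (n div p ^ j) * p ^ j" using div[of j n] by simp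
      hence "n div p ^ j \<in> D" using z(3) unfolding D_def by (metis dvd_mult_left mem_Collect_eq)
      thus "(case z of (j, n) \<Rightarrow> n div p ^ j) \<in> D" by (simp add: z)
    qed
  qed (rule fin)
  hence "(L + 1) * (card D - card E) \<le> card D"
    using ED fin by (simp add: card_cartesian_product card_Diff_subset finite_subset)
  moreover have "card E \<le> card D" using ED fin by (intro card_mono)
  ultimately show ?thesis
    unfolding D_def[symmetric] E_def[symmetric]
    by (auto dest!: le_Suc_ex simp: algebra_simps)
qed

section \<open>Spacing of the frequencies and the convergent majorant\<close>

lemma abs_ln_nat_quotient_ge:
  fixes a b :: nat
  assumes "a > 0" "b > 0" "a \<noteq> b"
  shows "\<bar>ln (real a / real b)\<bar> \<ge> 1 / real (max a b)"
proof -
  have *: "\<bar>ln (real a / real b)\<bar> \<ge> 1 / real b" if "0 < a" "a < b" for a b :: nat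
  proof -
    have "ln (real a / real b) \<le> real a / real b - 1"
      using that by (intro ln_le_minus_one) auto
    also have "\<dots> \<le> - (1 / real b)"
    proof -
      have "(real a + 1) / real b \<le> 1" using that by (simp add: divide_le_eq)
      thus ?thesis by (simp add: add_divide_distrib)
    qed
    finally show ?thesis by simp
  qed
  show ?thesis
  proof (cases "a < b")
    case True thus ?thesis using *[of a b] assms by (simp add: max_def)
  next
    case False thus ?thesis using *[of b a] assms by (simp add: max_def ln_div abs_minus_commute)
  qed
qed

lemma abs_ln_quotient_ge:
  fixes k m n Q :: nat
  assumes "0 < k" "0 < m" "0 < n" "m \<le> Q" "n \<le> Q" "Q \<ge> 2" "n * k \<noteq> m"
  shows "\<bar>ln (real m / real (n * k))\<bar> \<ge> (1 + ln (real k)) / (2 * real Q ^ 4)"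
proof (cases "k \<ge> Q ^ 2")
  case True
  have Q4: "real Q ^ 4 \<ge> 2 ^ 4" using assms by (intro power_mono) auto
  have k2: "real Q ^ 2 \<le> real k" using True by (metis of_nat_le_iff of_nat_power)
  have "2 * ln (real Q) \<le> ln (real k)"
  proof -
    have "2 * ln (real Q) = ln (real Q ^ 2)" using assms by (simp add: ln_realpow)
    also have "\<dots> \<le> ln (real k)" using k2 assms by simp
    finally show ?thesis .
  qed
  moreover define K q y x Z where "K = ln (real k)" and "q = ln (real Q)" and "y = ln (real m)"
    and "x = ln (real n)" and "Z = ln (real m / real (n * k))"
  ultimately have "2 * q \<le> K" by simp
  \<comment> \<open>This gives \<open>K \<ge> 4 / 3\<close>, so \<open>- K / 2\<close> lies below
    \<open>- (1 + K) / 4\<close>.\<close>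
  moreover have "2 / 3 \<le> q"
    using ln2_ge_two_thirds assms by (auto simp: q_def intro: order_trans)
  moreover have "Z = y - x - K"
    using assms by (simp add: Z_def K_def x_def y_def ln_div ln_mult)
  moreover have "y \<le> q" "x \<ge> 0" using assms by (auto simp: x_def y_def q_def)
  ultimately have "Z \<le> - ((1 + K) / 4)"
    by (simp add: field_simps)
  hence "(1 + K) / 4 \<le> \<bar>Z\<bar>"
    by linarith
  moreover have "(1 + ln (real k)) / (2 * real Q ^ 4) \<le> (1 + ln (real k)) / 4"
    using Q4 assms by (intro divide_left_mono) auto
  ultimately show ?thesis unfolding Z_def K_def by linarith
next
  case False
  have "real k < real Q ^ 2" using False by (metis not_le of_nat_less_iff of_nat_power)
  hence "ln (real k) \<le> ln (real Q ^ 2)"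
    using assms by simp
  hence "ln (real k) \<le> 2 * ln (real Q)"
    using assms by (simp add: ln_realpow)
  also have "\<dots> \<le> 2 * (real Q - 1)"
    using assms by (intro mult_left_mono ln_le_minus_one) auto
  finally have "1 + ln (real k) \<le> 2 * real Q" by simp
  hence "(1 + ln (real k)) / (2 * real Q ^ 4) \<le> (2 * real Q) / (2 * real Q ^ 4)"
    by (intro divide_right_mono) auto
  also have "\<dots> = 1 / real Q ^ 3"
    using assms by (simp add: field_simps power_numeral_reduce)
  also have "\<dots> \<le> 1 / real (max m (n * k))"
  proof (intro divide_left_mono)
    have "n * k \<le> Q * Q ^ 2" using assms False by (intro mult_mono) auto
    moreover have "m \<le> Q ^ 3" using assms by (meson le_trans self_le_power numeral_le_iff one_le_numeral zero_less_numeral order_trans[of 1 2 Q])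
    ultimately have "max m (n * k) \<le> Q ^ 3" by (simp add: power_numeral_reduce)
    thus "real (max m (n * k)) \<le> real Q ^ 3" by (metis of_nat_le_iff of_nat_power)
  qed (use assms in auto)
  also have "\<dots> \<le> \<bar>ln (real m / real (n * k))\<bar>"
    using assms by (intro abs_ln_nat_quotient_ge) auto
  finally show ?thesis .
qed

text \<open>Cauchy condensation reduces this to the sum of inverse squares. The term at 0 is 0 by
  the convention for division.\<close>

lemma summable_inverse_ln_sq: "summable (\<lambda>k. 1 / (real k * (1 + ln (real k)) ^ 2))"
proof -
  have "summable (\<lambda>n. 2 ^ n * (1 / (real (2 ^ n) * (1 + ln (real (2 ^ n))) ^ 2)))"
  proof (rule summable_comparison_test')
    show "summable (\<lambda>n. 1 / ln 2 ^ 2 * (1 / real n ^ 2))"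
      by (intro summable_mult) (use inverse_power_summable[of 2] in \<open>simp add: field_simps\<close>)
    fix n :: nat assume n: "n \<ge> 1"
    have "(real n * ln 2) ^ 2 \<le> (1 + real n * ln 2) ^ 2"
      by (intro power_mono) auto
    thus "norm (2 ^ n * (1 / (real (2 ^ n) * (1 + ln (real (2 ^ n))) ^ 2))) \<le> 1 / ln 2 ^ 2 * (1 / real n ^ 2)"
      using n by (simp add: ln_realpow power_mult_distrib frac_le mult.commute)
  qed
  thus ?thesis
    by (subst condensation_test) (auto intro!: divide_left_mono mult_mono power_mono add_nonneg_nonneg mult_pos_pos zero_less_power add_pos_nonneg)
qed

section \<open>The resonator and its kernel\<close>

lemma one_minus_cos_integral:
  fixes W :: real
  assumes W: "W > 0"
  shows "((\<lambda>t. complex_of_real (1 - cos ((t - a) / W))) has_integral of_real (2 * pi * W)) {a..a + 2 * pi * W}"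
proof -
  have "((\<lambda>t. 1 - cos ((t - a) / W)) has_integral
      ((a + 2 * pi * W - W * sin ((a + 2 * pi * W - a) / W)) - (a - W * sin ((a - a) / W)))) {a..a + 2 * pi * W}"
    using W by (intro fundamental_theorem_of_calculus)
      (auto intro!: derivative_eq_intros simp flip: has_real_derivative_iff_has_vector_derivative)
  hence "((\<lambda>t. 1 - cos ((t - a) / W)) has_integral (2 * pi * W)) {a..a + 2 * pi * W}"
    using W by simp
  thus ?thesis by (rule has_integral_of_real)
qed

text \<open>The kernel has the three frequencies \<open>x\<close> and
  \<open>x \<plusminus> h\<close> with \<open>h = 1 / W\<close>. Over a full period their boundary
  terms combine into a second difference of the reciprocal, of size \<open>h ^ 2 / |x| ^ 3\<close>.
  The condition \<open>W * |x| \<ge> 2\<close> keeps \<open>x\<close> away from \<open>h\<close> and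
  \<open>- h\<close>, so that \<open>x ^ 2 - h ^ 2\<close> is at least 3/4 of \<open>x ^ 2\<close>;
  two end points then give 8/3, rounded up to 3.\<close>

lemma cis_one_minus_cos_integral_bound:
  fixes W a x :: real
  assumes W: "W > 0" and x: "W * \<bar>x\<bar> \<ge> 2"
  obtains I where "((\<lambda>t. cis (x * t) * of_real (1 - cos ((t - a) / W))) has_integral I) {a..a + 2 * pi * W}"
    "norm I \<le> 3 / (W ^ 2 * \<bar>x\<bar> ^ 3)"
proof -
  define h where "h = 1 / W"
  have h: "h > 0" using W by (simp add: h_def)
  have xh: "\<bar>x\<bar> \<ge> 2 * h" using x W by (simp add: h_def field_simps)
  hence nz: "x \<noteq> 0" "x + h \<noteq> 0" "x - h \<noteq> 0" using h by auto
  define F where "F = (\<lambda>t. cis (x * t) / (\<i> * of_real x)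
     - (cis ((x + h) * t - h * a) / (\<i> * of_real (x + h)) + cis ((x - h) * t + h * a) / (\<i> * of_real (x - h))) / 2)"
  have cis_der: "((\<lambda>t. cis (u * t + v) / (\<i> * of_real u)) has_vector_derivative cis (u * t + v)) (at t within S)"
    if "u \<noteq> 0" for u v t :: real and S
  proof -
    have "((\<lambda>z. exp (\<i> * (of_real u * z + of_real v)) / (\<i> * of_real u)) has_field_derivative
        exp (\<i> * (of_real u * of_real t + of_real v))) (at (of_real t))"
      using that by (auto intro!: derivative_eq_intros simp: complex_eq_iff)
    from has_vector_derivative_real_field[OF this] show ?thesis
      by (simp add: cis_conv_exp)
  qed
  define c where "c = \<i> * of_real (h ^ 2 / (x * (x ^ 2 - h ^ 2)))"
  have eq: "cis (x * t) * of_real (1 - cos ((t - a) / W)) =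
      cis (x * t) - (cis ((x + h) * t - h * a) + cis ((x - h) * t + h * a)) / 2" for t
  proof -
    have 1: "(x + h) * t - h * a = x * t + h * (t - a)" "(x - h) * t + h * a = x * t - h * (t - a)"
      by (simp_all add: algebra_simps)
    have 2: "(t - a) / W = h * (t - a)" by (simp add: h_def)
    show ?thesis unfolding 1 2
      by (simp add: complex_eq_iff cos_add sin_add cos_diff sin_diff algebra_simps)
  qed
  have F: "(F has_vector_derivative (cis (x * t) * of_real (1 - cos ((t - a) / W)))) (at t within S)" for t S
  proof -
    have "(F has_vector_derivative cis (x * t) - (cis ((x + h) * t - h * a) + cis ((x - h) * t + h * a)) / 2) (at t within S)"
      unfolding F_def
      using cis_der[OF nz(1), of 0 t S] cis_der[OF nz(2), of "- (h * a)" t S] cis_der[OF nz(3), of "h * a" t S]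
      by (intro derivative_intros) auto
    thus ?thesis unfolding eq .
  qed
  \<comment> \<open>At both ends of the period the three exponentials coincide, which is what lets
    their denominators be combined.\<close>
  have F_end: "F t = c * cis (x * t)" if "h * (t - a) = 2 * pi * of_int j" for t and j :: int
  proof -
    have 1: "cis ((x + h) * t - h * a) = cis (x * t)"
    proof -
      have "(x + h) * t - h * a = x * t + 2 * pi * of_int j" using that by (simp add: algebra_simps)
      thus ?thesis by (simp add: cis_mult[symmetric])
    qed
    have 2: "cis ((x - h) * t + h * a) = cis (x * t)"
    proof -
      have "(x - h) * t + h * a = x * t - 2 * pi * of_int j" using that by (simp add: algebra_simps)
      thus ?thesis by (simp add: cis_divide[symmetric])
    qed
    have "1 / x - (1 / (x + h) + 1 / (x - h)) / 2 = - (h ^ 2 / (x * (x ^ 2 - h ^ 2)))"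
    proof -
      have "x ^ 2 - h ^ 2 = (x + h) * (x - h)" by (simp add: power2_eq_square algebra_simps)
      thus ?thesis using nz by (simp add: divide_simps) (simp add: power2_eq_square algebra_simps)
    qed
    hence 3: "complex_of_real (1 / x - (1 / (x + h) + 1 / (x - h)) / 2) = of_real (- (h ^ 2 / (x * (x ^ 2 - h ^ 2))))"
      by simp
    have "F t = cis (x * t) * (- \<i>) * of_real (1 / x - (1 / (x + h) + 1 / (x - h)) / 2)"
    proof -
      have inv: "z / (\<i> * of_real y) = z * (- \<i>) * of_real (1 / y)" for z y
        by (simp add: divide_inverse)
      have gen: "u * (- \<i>) * p - (u * (- \<i>) * q + u * (- \<i>) * r) / 2 = u * (- \<i>) * (p - (q + r) / 2)"
        for u p q r :: complex by (simp add: field_simps)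
      show ?thesis
        unfolding F_def 1 2 inv
        unfolding of_real_diff[of "1 / x"] of_real_divide[of _ 2] of_real_add[of "1 / _" "1 / _"] of_real_numeral
        by (rule gen)
    qed
    also have "\<dots> = c * cis (x * t)" unfolding 3 by (simp add: c_def)
    finally show ?thesis .
  qed
  show ?thesis
  proof (rule that[of "F (a + 2 * pi * W) - F a"])
    show "((\<lambda>t. cis (x * t) * of_real (1 - cos ((t - a) / W))) has_integral F (a + 2 * pi * W) - F a) {a..a + 2 * pi * W}"
      using W by (intro fundamental_theorem_of_calculus F) auto
    have "F a = c * cis (x * a)" by (rule F_end[of _ 0]) simp
    moreover have "F (a + 2 * pi * W) = c * cis (x * (a + 2 * pi * W))"
      using W by (intro F_end[of _ 1]) (simp add: h_def)
    ultimately have "norm (F (a + 2 * pi * W) - F a) \<le> norm (c * cis (x * (a + 2 * pi * W))) + norm (c * cis (x * a))"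
      by (simp only: norm_triangle_ineq4)
    also have "\<dots> = 2 * norm c" by (simp add: norm_mult)
    also have "norm c = h ^ 2 / (\<bar>x\<bar> * \<bar>x ^ 2 - h ^ 2\<bar>)"
      unfolding c_def norm_mult norm_of_real by (simp add: abs_mult)
    also have "2 * \<dots> \<le> 2 * (h ^ 2 / (\<bar>x\<bar> * (3 / 4 * \<bar>x\<bar> ^ 2)))"
    proof -
      have "(2 * h) ^ 2 \<le> \<bar>x\<bar> ^ 2" using xh h by (intro power_mono) auto
      hence "4 * h ^ 2 \<le> x ^ 2" by (simp add: power_mult_distrib)
      hence "3 / 4 * x ^ 2 \<le> \<bar>x ^ 2 - h ^ 2\<bar>" using abs_ge_self[of "x ^ 2 - h ^ 2"] by linarith
      moreover have "0 < x ^ 2" using nz by simp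
      ultimately have "3 / 4 * \<bar>x\<bar> ^ 2 \<le> \<bar>x ^ 2 - h ^ 2\<bar>" "\<bar>x ^ 2 - h ^ 2\<bar> > 0"
        by (simp, linarith)
      thus ?thesis using nz by (intro mult_left_mono divide_left_mono) auto
    qed
    also have "\<dots> \<le> 3 / (W ^ 2 * \<bar>x\<bar> ^ 3)"
    proof -
      have "2 * (h ^ 2 / (\<bar>x\<bar> * (3 / 4 * \<bar>x\<bar> ^ 2))) = 8 / 3 * (1 / (W ^ 2 * \<bar>x\<bar> ^ 3))"
        by (simp add: h_def power_divide power_numeral_reduce)
      also have "\<dots> \<le> 3 * (1 / (W ^ 2 * \<bar>x\<bar> ^ 3))"
        by (intro mult_right_mono) auto
      finally show ?thesis by simp
    qed
    finally show "norm (F (a + 2 * pi * W) - F a) \<le> 3 / (W ^ 2 * \<bar>x\<bar> ^ 3)" .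
  qed
qed

section \<open>The resonator and its weighted moments\<close>

text \<open>\<open>size (prime_factorization n)\<close> counts prime factors with multiplicity, so
  the coefficients are completely multiplicative in \<open>n\<close>. This makes the phase on the
  diagonal independent of \<open>n\<close>.\<close>

definition resonator :: "complex \<Rightarrow> nat \<Rightarrow> real \<Rightarrow> complex" where
  "resonator w Q t = (\<Sum>n | n dvd Q. w ^ size (prime_factorization n) * cis (t * ln (real n)))"

definition weight :: "complex \<Rightarrow> nat \<Rightarrow> real \<Rightarrow> real \<Rightarrow> real \<Rightarrow> real" where
  "weight w Q a W t = norm (resonator w Q t) ^ 2 * (1 - cos ((t - a) / W))"

lemma weight_nonneg: "weight w Q a W t \<ge> 0"
  by (simp add: weight_def)

lemma continuous_on_weight: "continuous_on A (weight w Q a W)"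
  unfolding weight_def[abs_def] resonator_def divide_inverse cis_conv_exp
  by (intro continuous_intros)

lemma weight_expand:
  assumes "Q > 0" "k > 0"
  shows "cis (- t * ln (real k)) * of_real (weight w Q a W t) =
    (\<Sum>m | m dvd Q. \<Sum>n | n dvd Q. w ^ size (prime_factorization m) * cnj (w ^ size (prime_factorization n)) *
       (cis (ln (real m / real (n * k)) * t) * of_real (1 - cos ((t - a) / W))))"
proof -
  let ?u = "\<lambda>n. w ^ size (prime_factorization n)"
  have "complex_of_real (norm (resonator w Q t) ^ 2) = resonator w Q t * cnj (resonator w Q t)"
    by (rule complex_norm_square)
  also have "\<dots> = (\<Sum>m | m dvd Q. \<Sum>n | n dvd Q. ?u m * cnj (?u n) * (cis (t * ln (real m)) * cis (- (t * ln (real n)))))"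
    unfolding resonator_def cnj_sum sum_product by (simp add: cis_cnj mult_ac)
  finally have "cis (- t * ln (real k)) * of_real (weight w Q a W t) =
     (\<Sum>m | m dvd Q. \<Sum>n | n dvd Q. ?u m * cnj (?u n) *
       (cis (t * ln (real m)) * cis (- (t * ln (real n))) * cis (- t * ln (real k)) * of_real (1 - cos ((t - a) / W))))"
    unfolding weight_def of_real_mult by (simp add: sum_distrib_left sum_distrib_right mult_ac)
  also have "\<dots> = (\<Sum>m | m dvd Q. \<Sum>n | n dvd Q. ?u m * cnj (?u n) *
       (cis (ln (real m / real (n * k)) * t) * of_real (1 - cos ((t - a) / W))))"
  proof (intro sum.cong refl)
    fix m n assume "m \<in> {m. m dvd Q}" "n \<in> {n. n dvd Q}"
    hence mn: "m > 0" "n > 0" using assms by (auto intro: dvd_pos_nat)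
    have "cis (t * ln (real m)) * cis (- (t * ln (real n))) * cis (- t * ln (real k)) = cis (ln (real m / real (n * k)) * t)"
      using mn assms by (simp add: cis_mult ln_div ln_mult algebra_simps)
    thus "?u m * cnj (?u n) * (cis (t * ln (real m)) * cis (- (t * ln (real n))) * cis (- t * ln (real k)) * of_real (1 - cos ((t - a) / W)))
      = ?u m * cnj (?u n) * (cis (ln (real m / real (n * k)) * t) * of_real (1 - cos ((t - a) / W)))"
      by simp
  qed
  finally show ?thesis .
qed

text \<open>The diagonal pairs \<open>m = n * k\<close> each give the mass \<open>2 * pi * W\<close>
  of the kernel, with phase \<open>w\<close> to the number of prime factors of \<open>k\<close>.
  Every other pair has \<open>|x| \<ge> (1 + ln k) / (2 * Q ^ 4)\<close>: the hypothesis on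
  \<open>W\<close> is what yields \<open>W * |x| \<ge> 2\<close>, and \<open>3 * 2 ^ 3 = 24\<close>
  and \<open>Q ^ 12\<close> come from cubing the spacing.\<close>

lemma weight_integral:
  fixes W a :: real
  assumes Q: "Q \<ge> 2" and k: "k > 0" and W: "W \<ge> 4 * real Q ^ 4" and w: "norm w = 1"
  obtains I where "((\<lambda>t. cis (- t * ln (real k)) * of_real (weight w Q a W t)) has_integral I) {a..a + 2 * pi * W}"
    "norm (I - of_real (2 * pi * W * real (card {n. n * k dvd Q})) * w ^ size (prime_factorization k)) \<le>
       real (card {n. n dvd Q}) ^ 2 * (24 * real Q ^ 12 / W ^ 2 / (1 + ln (real k)) ^ 3)"
proof -
  define e where "e = 24 * real Q ^ 12 / W ^ 2 / (1 + ln (real k)) ^ 3"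
  define N where "N = {n. n dvd Q}"
  define u where "u = (\<lambda>n::nat. w ^ size (prime_factorization n))"
  define d where "d = (\<lambda>m n. if m = n * k then complex_of_real (2 * pi * W) else 0)"
  have Q4: "real Q ^ 4 > 0" using Q by simp
  have W0: "W > 0" using W Q4 by linarith
  have e0: "e \<ge> 0" using k by (simp add: e_def)
  have finN: "finite N" using Q by (simp add: N_def)
  have Npos: "n > 0" if "n \<in> N" for n using that Q by (auto simp: N_def intro!: Nat.gr0I)
  have u1: "norm (u n) = 1" for n by (simp add: u_def norm_power w)
  have "\<exists>I. ((\<lambda>t. cis (ln (real m / real (n * k)) * t) * of_real (1 - cos ((t - a) / W))) has_integral I) {a..a + 2 * pi * W}
      \<and> norm (I - d m n) \<le> e" if mn: "m \<in> N" "n \<in> N" for m n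
  proof (cases "m = n * k")
    case True
    thus ?thesis
      using one_minus_cos_integral[OF W0, of a] e0 Npos[OF mn(2)] k
      by (intro exI[of _ "of_real (2 * pi * W)"]) (auto simp: d_def)
  next
    case False
    define x where "x = ln (real m / real (n * k))"
    have xge: "\<bar>x\<bar> \<ge> (1 + ln (real k)) / (2 * real Q ^ 4)"
      unfolding x_def using False Q k Npos[OF mn(1)] Npos[OF mn(2)] mn
      by (intro abs_ln_quotient_ge) (auto simp: N_def intro!: dvd_imp_le)
    have k1: "1 + ln (real k) \<ge> 1" using k by simp
    have "2 \<le> 4 * real Q ^ 4 * (1 / (2 * real Q ^ 4))" using Q4 by simp
    also have "\<dots> \<le> W * \<bar>x\<bar>"
    proof (rule mult_mono[OF W])
      have "1 / (2 * real Q ^ 4) \<le> (1 + ln (real k)) / (2 * real Q ^ 4)"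
        using k1 by (intro divide_right_mono) auto
      thus "1 / (2 * real Q ^ 4) \<le> \<bar>x\<bar>" using xge by linarith
    qed (use W0 in auto)
    finally have Wx: "W * \<bar>x\<bar> \<ge> 2" .
    obtain I where I: "((\<lambda>t. cis (x * t) * of_real (1 - cos ((t - a) / W))) has_integral I) {a..a + 2 * pi * W}"
      "norm I \<le> 3 / (W ^ 2 * \<bar>x\<bar> ^ 3)"
      by (rule cis_one_minus_cos_integral_bound[OF W0 Wx]) (rule that)
    note I(2)
    also have "3 / (W ^ 2 * \<bar>x\<bar> ^ 3) \<le> 3 / (W ^ 2 * ((1 + ln (real k)) / (2 * real Q ^ 4)) ^ 3)"
    proof (intro divide_left_mono mult_left_mono power_mono xge)
      have "(1 + ln (real k)) / (2 * real Q ^ 4) > 0" using k1 Q4 by (intro divide_pos_pos) auto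
      moreover from this xge have "\<bar>x\<bar> > 0" by linarith
      ultimately show "0 < W ^ 2 * \<bar>x\<bar> ^ 3 * (W ^ 2 * ((1 + ln (real k)) / (2 * real Q ^ 4)) ^ 3)"
        using W0 by (intro mult_pos_pos zero_less_power)
    qed (use k1 Q4 in auto)
    also have "\<dots> = e"
      by (simp add: e_def power_divide power_mult_distrib flip: power_mult)
    finally show ?thesis using I(1) False by (auto simp: d_def x_def)
  qed
  note ex = this
  define I where "I = (\<lambda>m n. SOME I. ((\<lambda>t. cis (ln (real m / real (n * k)) * t) * of_real (1 - cos ((t - a) / W))) has_integral I) {a..a + 2 * pi * W}
      \<and> norm (I - d m n) \<le> e)"
  have I: "((\<lambda>t. cis (ln (real m / real (n * k)) * t) * of_real (1 - cos ((t - a) / W))) has_integral I m n) {a..a + 2 * pi * W}"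
     "norm (I m n - d m n) \<le> e" if mn: "m \<in> N" "n \<in> N" for m n :: nat
    unfolding I_def
    by (rule someI_ex[OF ex[OF mn], THEN conjunct1], rule someI_ex[OF ex[OF mn], THEN conjunct2])
  have diag: "(\<Sum>m\<in>N. \<Sum>n\<in>N. u m * cnj (u n) * d m n) =
      of_real (2 * pi * W * real (card {n. n * k dvd Q})) * w ^ size (prime_factorization k)"
  proof -
    have "(\<Sum>m\<in>N. \<Sum>n\<in>N. u m * cnj (u n) * d m n) = (\<Sum>n\<in>N. \<Sum>m\<in>N. u m * cnj (u n) * d m n)"
      by (rule sum.swap)
    also have "\<dots> = (\<Sum>n\<in>N. if n * k \<in> N then of_real (2 * pi * W) * u k else 0)"
    proof (rule sum.cong[OF refl])
      fix n assume n: "n \<in> N"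
      have "(\<Sum>m\<in>N. u m * cnj (u n) * d m n) = (\<Sum>m\<in>N. if m = n * k then u (n * k) * cnj (u n) * of_real (2 * pi * W) else 0)"
        by (intro sum.cong) (auto simp: d_def)
      also have "\<dots> = (if n * k \<in> N then u (n * k) * cnj (u n) * of_real (2 * pi * W) else 0)"
        using finN by (simp add: sum.delta)
      also have "u (n * k) * cnj (u n) = u k"
      proof -
        have "u (n * k) = u n * u k"
          using Npos[OF n] k by (simp add: u_def prime_factorization_mult power_add)
        moreover have "u n * cnj (u n) = 1"
          using u1[of n] by (simp add: complex_norm_square[symmetric])
        ultimately show ?thesis by (simp add: mult_ac)
      qed
      finally show "(\<Sum>m\<in>N. u m * cnj (u n) * d m n) = (if n * k \<in> N then of_real (2 * pi * W) * u k else 0)"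
        by (simp add: mult_ac)
    qed
    also have "\<dots> = of_nat (card {n. n * k dvd Q}) * (of_real (2 * pi * W) * u k)"
    proof -
      have "N \<inter> {n. n * k \<in> N} = {n. n * k dvd Q}" by (auto simp: N_def intro: dvd_mult_left)
      thus ?thesis using finN by (simp add: sum.If_cases)
    qed
    finally show ?thesis by (simp add: u_def)
  qed
  show ?thesis
  proof (rule that[of "\<Sum>m\<in>N. \<Sum>n\<in>N. u m * cnj (u n) * I m n"])
    have "((\<lambda>t. \<Sum>m\<in>N. \<Sum>n\<in>N. u m * cnj (u n) * (cis (ln (real m / real (n * k)) * t) * of_real (1 - cos ((t - a) / W))))
        has_integral (\<Sum>m\<in>N. \<Sum>n\<in>N. u m * cnj (u n) * I m n)) {a..a + 2 * pi * W}"
      by (intro has_integral_sum finN has_integral_mult_right I)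
    thus "((\<lambda>t. cis (- t * ln (real k)) * of_real (weight w Q a W t)) has_integral (\<Sum>m\<in>N. \<Sum>n\<in>N. u m * cnj (u n) * I m n)) {a..a + 2 * pi * W}"
      using Q k by (subst weight_expand) (auto simp: N_def u_def)
    have "norm ((\<Sum>m\<in>N. \<Sum>n\<in>N. u m * cnj (u n) * I m n) - (\<Sum>m\<in>N. \<Sum>n\<in>N. u m * cnj (u n) * d m n))
      = norm (\<Sum>m\<in>N. \<Sum>n\<in>N. u m * cnj (u n) * (I m n - d m n))"
      by (simp add: sum_subtractf algebra_simps)
    also have "\<dots> \<le> (\<Sum>m\<in>N. \<Sum>n\<in>N. e)"
      using I(2) by (intro sum_norm_le) (auto simp: norm_mult u1)
    also have "\<dots> = real (card N) ^ 2 * e" by (simp add: power2_eq_square)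
    finally show "norm ((\<Sum>m\<in>N. \<Sum>n\<in>N. u m * cnj (u n) * I m n) - of_real (2 * pi * W * real (card {n. n * k dvd Q})) * w ^ size (prime_factorization k)) \<le>
       real (card {n. n dvd Q}) ^ 2 * (24 * real Q ^ 12 / W ^ 2 / (1 + ln (real k)) ^ 3)"
      unfolding diag by (simp add: N_def e_def)
  qed
qed

section \<open>Integrating the logarithmic derivative against the weight\<close>

text \<open>For \<sigma> > 1 the series converges uniformly in \<open>t\<close>, so sum and integral
  may be exchanged. This is the reason for working to the right of the line first.\<close>

lemma mangoldt_series_weight_integral:
  fixes \<sigma> a b :: real
  assumes \<sigma>: "\<sigma> > 1"
  obtains J where
    "((\<lambda>t. mangoldt_series (of_real \<sigma> + \<i> * of_real t) * of_real (weight w Q a W t)) has_integral J) {a..b}"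
    "(\<lambda>k. of_real (mangoldt k * real k powr - \<sigma>) *
        integral {a..b} (\<lambda>t. cis (- t * ln (real k)) * of_real (weight w Q a W t))) sums J"
proof -
  let ?g = "\<lambda>k t. cis (- t * ln (real k)) * complex_of_real (weight w Q a W t)"
  let ?f = "\<lambda>k t. complex_of_real (mangoldt k * real k powr - \<sigma>) * ?g k t"
  obtain M where M: "M \<ge> 0" "\<And>t. t \<in> {a..b} \<Longrightarrow> norm (weight w Q a W t) \<le> M"
    by (rule continuous_on_compact_bound[OF compact_Icc continuous_on_weight]) (rule that)
  have contg: "continuous_on {a..b} (?g k)" for k
    unfolding cis_conv_exp by (intro continuous_intros continuous_on_weight)
  have "uniform_limit {a..b} (\<lambda>n t. \<Sum>k<n. ?f k t) (\<lambda>t. \<Sum>k. ?f k t) sequentially"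
  proof (rule Weierstrass_m_test)
    show "norm (?f k t) \<le> mangoldt k * real k powr - \<sigma> * M" if "t \<in> {a..b}" for k t
      unfolding norm_mult norm_of_real using M(2)[OF that]
      by (auto simp: abs_mult intro!: mult_left_mono mangoldt_nonneg mult_nonneg_nonneg)
    show "summable (\<lambda>k. mangoldt k * real k powr - \<sigma> * M)"
      by (intro summable_mult2 summable_mangoldt_powr \<sigma>)
  qed
  then obtain I J where IJ: "\<And>n. ((\<lambda>t. \<Sum>k<n. ?f k t) has_integral I n) {a..b}"
      "((\<lambda>t. \<Sum>k. ?f k t) has_integral J) {a..b}" "I \<longlonglongrightarrow> J"
    by (rule uniform_limit_integral) (intro continuous_intros contg, simp, rule that)
  have fk: "?f k t = mangoldt k * of_nat k powr - (of_real \<sigma> + \<i> * of_real t) * of_real (weight w Q a W t)" for k t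
  proof (cases "k = 0")
    case False
    thus ?thesis by (subst nat_powr_cis) simp_all
  qed simp
  have "(\<lambda>k. ?f k t) sums (mangoldt_series (of_real \<sigma> + \<i> * of_real t) * of_real (weight w Q a W t))" for t
    unfolding fk by (rule sums_mult2[OF mangoldt_series_sums]) (use \<sigma> in simp)
  hence eq: "(\<Sum>k. ?f k t) = mangoldt_series (of_real \<sigma> + \<i> * of_real t) * of_real (weight w Q a W t)" for t
    by (rule sums_unique[symmetric])
  have In: "I n = (\<Sum>k<n. of_real (mangoldt k * real k powr - \<sigma>) * integral {a..b} (?g k))" for n
  proof (rule has_integral_unique[OF IJ(1)])
    show "((\<lambda>t. \<Sum>k<n. ?f k t) has_integral (\<Sum>k<n. of_real (mangoldt k * real k powr - \<sigma>) * integral {a..b} (?g k))) {a..b}"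
      by (intro has_integral_sum finite_lessThan has_integral_mult_right integrable_integral
          integrable_continuous_interval contg)
  qed
  have "(\<lambda>k. of_real (mangoldt k * real k powr - \<sigma>) * integral {a..b} (?g k)) sums J"
    using IJ(3) unfolding sums_def In[symmetric] .
  moreover have "((\<lambda>t. mangoldt_series (of_real \<sigma> + \<i> * of_real t) * of_real (weight w Q a W t)) has_integral J) {a..b}"
    using IJ(2) unfolding eq .
  ultimately show ?thesis by (intro that)
qed

text \<open>
  On the diagonal \<open>m = n * k\<close> the phases multiply to \<open>cnj w * w ^ \<Omega> k\<close>, which is \<open>1\<close> for primes and has
  real part at least \<open>-1\<close> otherwise.
\<close>

definition resonance_coeff :: "nat \<Rightarrow> nat \<Rightarrow> real" where
  "resonance_coeff Q k = (if prime k then 1 else - 1) * real (card {n. n * k dvd Q})"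

text \<open>The case \<open>k = 1\<close> of the moment formula, where the exponential, the phase
  and \<open>1 + ln k\<close> are all 1.\<close>

lemma weight_integral_error:
  fixes W a :: real
  assumes Q: "Q \<ge> 2" and W: "W \<ge> 4 * real Q ^ 4" and w: "norm w = 1"
  shows "\<bar>integral {a..a + 2 * pi * W} (weight w Q a W) - 2 * pi * W * real (card {n. n dvd Q})\<bar>
          \<le> real (card {n. n dvd Q}) ^ 2 * (24 * real Q ^ 12 / W ^ 2)"
proof -
  let ?b = "a + 2 * pi * W"
  obtain I where I: "((\<lambda>t. cis (- t * ln (real 1)) * of_real (weight w Q a W t)) has_integral I) {a..?b}"
    "norm (I - of_real (2 * pi * W * real (card {n. n * 1 dvd Q})) * w ^ size (prime_factorization (1::nat))) \<le>
       real (card {n. n dvd Q}) ^ 2 * (24 * real Q ^ 12 / W ^ 2 / (1 + ln (real 1)) ^ 3)"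
    by (rule weight_integral[OF Q zero_less_one W w, of a]) (rule that)
  have "((\<lambda>t. complex_of_real (weight w Q a W t)) has_integral of_real (integral {a..?b} (weight w Q a W))) {a..?b}"
    by (intro has_integral_of_real integrable_integral integrable_continuous_interval continuous_on_weight)
  hence "I = of_real (integral {a..?b} (weight w Q a W))"
    using I(1) by (auto intro: has_integral_unique)
  hence "I - of_real (2 * pi * W * real (card {n. n * 1 dvd Q})) * w ^ size (prime_factorization (1::nat)) =
     of_real (integral {a..?b} (weight w Q a W) - 2 * pi * W * real (card {n. n dvd Q}))"
    by simp
  thus ?thesis using I(2) by (simp del: of_real_diff of_real_mult)
qed

text \<open>The right side bounds the weighted integral from above because the weight is
  nonnegative; the left side bounds it from below term by term. In the error term \<sigma> has
  already been replaced by 1, so the bound survives the limit.\<close>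

lemma resonance_lower_bound_Re_gt_1:
  fixes W a M \<sigma> :: real
  assumes Q: "Q \<ge> 2" and W: "W \<ge> 4 * real Q ^ 4" and w: "norm w = 1" and \<sigma>: "\<sigma> > 1"
    and M: "\<And>t. t \<in> {a..a + 2 * pi * W} \<Longrightarrow> Re (cnj w * mangoldt_series (of_real \<sigma> + \<i> * of_real t)) \<le> M"
  shows "2 * pi * W * (\<Sum>k | k dvd Q. mangoldt k * real k powr - \<sigma> * resonance_coeff Q k)
           - real (card {n. n dvd Q}) ^ 2 * (24 * real Q ^ 12 / W ^ 2) * (\<Sum>k. 1 / (real k * (1 + ln (real k)) ^ 2))
         \<le> M * integral {a..a + 2 * pi * W} (weight w Q a W)"
proof -
  let ?b = "a + 2 * pi * W"
  define H where "H = (\<lambda>k. integral {a..?b} (\<lambda>t. cis (- t * ln (real k)) * of_real (weight w Q a W t)))"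
  define e where "e = real (card {n. n dvd Q}) ^ 2 * (24 * real Q ^ 12 / W ^ 2)"
  have e0: "e \<ge> 0" by (simp add: e_def)
  have W0: "W \<ge> 0" using W by (rule order_trans[rotated]) simp
  obtain J where J:
    "((\<lambda>t. mangoldt_series (of_real \<sigma> + \<i> * of_real t) * of_real (weight w Q a W t)) has_integral J) {a..?b}"
    "(\<lambda>k. of_real (mangoldt k * real k powr - \<sigma>) *
        integral {a..?b} (\<lambda>t. cis (- t * ln (real k)) * of_real (weight w Q a W t))) sums J"
    by (rule mangoldt_series_weight_integral[OF \<sigma>]) (rule that)
  note J1 = J(1)
  have J2: "(\<lambda>k. of_real (mangoldt k * real k powr - \<sigma>) * H k) sums J"
    using J(2) by (simp only: H_def)
  have "((\<lambda>t. Re (cnj w * (mangoldt_series (of_real \<sigma> + \<i> * of_real t) * of_real (weight w Q a W t)))) has_integral Re (cnj w * J)) {a..?b}"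
    by (intro has_integral_Re has_integral_mult_right J1)
  moreover have "((\<lambda>t. M * weight w Q a W t) has_integral M * integral {a..?b} (weight w Q a W)) {a..?b}"
    by (intro has_integral_mult_right integrable_integral integrable_continuous_interval continuous_on_weight)
  ultimately have upper: "Re (cnj w * J) \<le> M * integral {a..?b} (weight w Q a W)"
  proof (rule has_integral_le)
    fix t assume t: "t \<in> {a..?b}"
    have "Re (cnj w * (mangoldt_series (of_real \<sigma> + \<i> * of_real t) * of_real (weight w Q a W t))) =
        Re (cnj w * mangoldt_series (of_real \<sigma> + \<i> * of_real t)) * weight w Q a W t"
      by (simp add: algebra_simps)
    also have "\<dots> \<le> M * weight w Q a W t"
      using M[OF t] by (intro mult_right_mono weight_nonneg)
    finally show "Re (cnj w * (mangoldt_series (of_real \<sigma> + \<i> * of_real t) * of_real (weight w Q a W t))) \<le> M * weight w Q a W t" .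
  qed
  define A where "A = (\<lambda>k. 2 * pi * W * (mangoldt k * real k powr - \<sigma> * resonance_coeff Q k))"
  define B where "B = (\<lambda>k. e * (1 / (real k * (1 + ln (real k)) ^ 2)))"
  have "A sums (\<Sum>k | k dvd Q. A k)"
  proof (rule sums_finite)
    show "finite {k. k dvd Q}" using Q by simp
    fix k assume "k \<notin> {k. k dvd Q}"
    hence "{n. n * k dvd Q} = {}" by (auto intro: dvd_mult_right)
    thus "A k = 0" by (simp add: A_def resonance_coeff_def)
  qed
  moreover have "B sums (e * (\<Sum>k. 1 / (real k * (1 + ln (real k)) ^ 2)))"
    unfolding B_def by (intro sums_mult summable_sums summable_inverse_ln_sq)
  ultimately have "(\<lambda>k. A k - B k) sums ((\<Sum>k | k dvd Q. A k) - e * (\<Sum>k. 1 / (real k * (1 + ln (real k)) ^ 2)))"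
    by (rule sums_diff)
  moreover have "(\<lambda>k. Re (cnj w * (of_real (mangoldt k * real k powr - \<sigma>) * H k))) sums Re (cnj w * J)"
    by (intro sums_Re sums_mult J2)
  ultimately have "(\<Sum>k | k dvd Q. A k) - e * (\<Sum>k. 1 / (real k * (1 + ln (real k)) ^ 2)) \<le> Re (cnj w * J)"
  proof (rule sums_le[rotated])
    fix k
    show "A k - B k \<le> Re (cnj w * (of_real (mangoldt k * real k powr - \<sigma>) * H k))"
    proof (cases "k = 0")
      case False
      define E where "E = real (card {n. n * k dvd Q})"
      define l where "l = size (prime_factorization k)"
      define r where "r = e / (1 + ln (real k)) ^ 3"
      have k: "k > 0" "ln (real k) \<ge> 0" using False by auto
      obtain I where I: "((\<lambda>t. cis (- t * ln (real k)) * of_real (weight w Q a W t)) has_integral I) {a..?b}"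
        "norm (I - of_real (2 * pi * W * real (card {n. n * k dvd Q})) * w ^ size (prime_factorization k)) \<le>
           real (card {n. n dvd Q}) ^ 2 * (24 * real Q ^ 12 / W ^ 2 / (1 + ln (real k)) ^ 3)"
        by (rule weight_integral[OF Q k(1) W w, of a]) (rule that)
      have "H k = I" unfolding H_def using I(1) by (rule integral_unique)
      hence H: "norm (H k - of_real (2 * pi * W * E) * w ^ l) \<le> r"
        using I(2) by (simp add: E_def l_def r_def e_def)
      have "Re (cnj w * H k) = 2 * pi * W * E * Re (cnj w * w ^ l) + Re (cnj w * (H k - of_real (2 * pi * W * E) * w ^ l))"
        by (simp add: algebra_simps)
      moreover have "\<bar>Re (cnj w * (H k - of_real (2 * pi * W * E) * w ^ l))\<bar> \<le> r"
        using H w by (intro order_trans[OF abs_Re_le_cmod]) (simp add: norm_mult)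
      moreover have "Re (cnj w * w ^ l) \<ge> (if prime k then 1 else - 1)"
      proof (cases "prime k")
        case True
        hence "l = 1" by (simp add: l_def prime_factorization_prime)
        moreover have "w * cnj w = 1" using w by (simp flip: complex_norm_square)
        ultimately show ?thesis by (simp add: mult.commute)
      next
        case False
        have "\<bar>Re (cnj w * w ^ l)\<bar> \<le> norm (cnj w * w ^ l)" by (rule abs_Re_le_cmod)
        also have "\<dots> = 1" by (simp add: norm_mult norm_power w)
        finally show ?thesis using False by simp
      qed
      hence "2 * pi * W * E * Re (cnj w * w ^ l) \<ge> 2 * pi * W * E * (if prime k then 1 else - 1)"
        using W0 by (intro mult_left_mono) (auto simp: E_def)
      moreover have "2 * pi * W * E * (if prime k then 1 else - 1) = 2 * pi * W * resonance_coeff Q k"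
        by (simp add: resonance_coeff_def E_def)
      ultimately have "2 * pi * W * resonance_coeff Q k - r \<le> Re (cnj w * H k)"
        by linarith
      hence "mangoldt k * real k powr - \<sigma> * (2 * pi * W * resonance_coeff Q k - r) \<le> mangoldt k * real k powr - \<sigma> * Re (cnj w * H k)"
        by (intro mult_left_mono mult_nonneg_nonneg mangoldt_nonneg) auto
      \<comment> \<open>The von Mangoldt factor consumes one of the three powers of
        \<open>1 + ln k\<close>; the square that remains is still enough for convergence.\<close>
      moreover have "mangoldt k * real k powr - \<sigma> * r \<le> B k"
      proof -
        have "mangoldt k \<le> 1 + ln (real k)" using mangoldt_le_ln[of k] by simp
        moreover have "real k powr - \<sigma> \<le> real k powr - 1" using \<sigma> k by (intro powr_mono) auto
        ultimately have "mangoldt k * real k powr - \<sigma> * r \<le> (1 + ln (real k)) * real k powr - 1 * r"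
          using k e0 by (intro mult_mono mult_right_mono) (auto simp: r_def)
        also have "\<dots> = B k"
          using k by (simp add: B_def r_def powr_minus_divide power_numeral_reduce add_nonneg_eq_0_iff)
        finally show ?thesis .
      qed
      moreover have "mangoldt k * real k powr - \<sigma> * (2 * pi * W * resonance_coeff Q k - r) = A k - mangoldt k * real k powr - \<sigma> * r"
        by (simp add: A_def algebra_simps)
      moreover have "Re (cnj w * (of_real (mangoldt k * real k powr - \<sigma>) * H k)) = mangoldt k * real k powr - \<sigma> * Re (cnj w * H k)"
        by (simp add: algebra_simps)
      ultimately show ?thesis by linarith
    qed (simp add: A_def B_def)
  qed
  also have "(\<Sum>k | k dvd Q. A k) = 2 * pi * W * (\<Sum>k | k dvd Q. mangoldt k * real k powr - \<sigma> * resonance_coeff Q k)"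
    by (simp add: A_def sum_distrib_left)
  finally show ?thesis using upper by (simp add: e_def)
qed

text \<open>On the compact rectangle \<open>K\<close> the logarithmic derivative has no singularity,
  because \<open>a > 0\<close> excludes the pole and zeta has no zeros there. Uniform continuity
  carries an upper bound on the line to nearby \<sigma> at the cost of \<epsilon>. The main term is
  a finite sum, hence continuous in \<sigma>.\<close>

lemma resonance_lower_bound:
  fixes W a M :: real
  assumes Q: "Q \<ge> 2" and W: "W \<ge> 4 * real Q ^ 4" and w: "norm w = 1" and a: "a > 0"
    and M: "\<And>t. t \<in> {a..a + 2 * pi * W} \<Longrightarrow>
      Re (cnj w * - (deriv zeta (1 + \<i> * of_real t) / zeta (1 + \<i> * of_real t))) \<le> M"
  shows "2 * pi * W * (\<Sum>k | k dvd Q. mangoldt k / real k * resonance_coeff Q k)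
           - real (card {n. n dvd Q}) ^ 2 * (24 * real Q ^ 12 / W ^ 2) * (\<Sum>k. 1 / (real k * (1 + ln (real k)) ^ 2))
         \<le> M * integral {a..a + 2 * pi * W} (weight w Q a W)"
    (is "?X \<le> M * ?I")
proof -
  let ?b = "a + 2 * pi * W"
  define X where "X = (\<lambda>\<sigma>. 2 * pi * W * (\<Sum>k | k dvd Q. mangoldt k * real k powr - \<sigma> * resonance_coeff Q k)
           - real (card {n. n dvd Q}) ^ 2 * (24 * real Q ^ 12 / W ^ 2) * (\<Sum>k. 1 / (real k * (1 + ln (real k)) ^ 2)))"
  define f where "f = (\<lambda>s. cnj w * - (deriv zeta s / zeta s))"
  define K where "K = cbox (Complex 1 a) (Complex 2 ?b)"
  have nz: "s \<noteq> 1 \<and> zeta s \<noteq> 0" if "s \<in> K" for s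
  proof -
    have s: "Re s \<ge> 1" "Im s > 0" using that a by (auto simp: K_def in_cbox_complex_iff)
    show ?thesis
    proof (cases "Re s = 1")
      case True
      hence "s = 1 + \<i> * of_real (Im s)" by (simp add: complex_eq_iff)
      thus ?thesis using zeta_nonzero_Re_eq_1[of "Im s"] s by auto
    next
      case False
      thus ?thesis using zeta_nonzero_Re_gt_1[of s] s by auto
    qed
  qed
  have "continuous_on K f"
  proof -
    have "deriv zeta holomorphic_on (- {1})"
      by (intro holomorphic_deriv zeta_holomorphic) auto
    hence "continuous_on K (deriv zeta)" "continuous_on K zeta"
      using nz zeta_holomorphic by (auto intro!: holomorphic_on_imp_continuous_on elim!: holomorphic_on_subset)
    thus ?thesis unfolding f_def using nz by (intro continuous_intros) auto
  qed
  hence unif: "uniformly_continuous_on K f"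
    by (rule compact_uniformly_continuous) (simp add: K_def compact_cbox)
  have I0: "?I \<ge> 0"
    by (intro integral_nonneg integrable_continuous_interval continuous_on_weight) (simp add: weight_nonneg)
  have lim: "((\<lambda>\<sigma>. X \<sigma>) \<longlongrightarrow> ?X) (at_right 1)"
  proof -
    have "((\<lambda>\<sigma>. X \<sigma>) \<longlongrightarrow> X 1) (at_right 1)"
      unfolding X_def using Q by (intro tendsto_intros) (auto intro!: Nat.gr0I)
    thus ?thesis by (simp add: X_def powr_minus_divide)
  qed
  have "?X \<le> (M + \<epsilon>) * ?I" if \<epsilon>: "\<epsilon> > 0" for \<epsilon>
  proof (rule tendsto_upperbound[OF lim])
    obtain d where d: "d > 0" "\<And>x x'. x \<in> K \<Longrightarrow> x' \<in> K \<Longrightarrow> dist x' x < d \<Longrightarrow> dist (f x') (f x) < \<epsilon>"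
      using unif \<epsilon> unfolding uniformly_continuous_on_def by metis
    have "eventually (\<lambda>\<sigma>. \<sigma> \<in> {1<..<min 2 (1 + d)}) (at_right 1)"
      using d(1) by (intro eventually_at_right_real) auto
    thus "eventually (\<lambda>\<sigma>. X \<sigma> \<le> (M + \<epsilon>) * ?I) (at_right 1)"
    proof eventually_elim
      case (elim \<sigma>)
      hence \<sigma>: "\<sigma> > 1" "\<sigma> \<le> 2" "\<sigma> - 1 < d" by auto
      show ?case unfolding X_def
      proof (rule resonance_lower_bound_Re_gt_1[OF Q W w \<sigma>(1)])
        fix t assume t: "t \<in> {a..?b}"
        define s where "s = complex_of_real \<sigma> + \<i> * of_real t"
        define s1 where "s1 = 1 + \<i> * complex_of_real t"
        have "s \<in> K" "s1 \<in> K" using t \<sigma> by (auto simp: K_def in_cbox_complex_iff s_def s1_def)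
        moreover have "dist s s1 < d"
        proof -
          have "s - s1 = of_real (\<sigma> - 1)" by (simp add: s_def s1_def)
          thus ?thesis using \<sigma> by (simp add: dist_norm del: of_real_diff)
        qed
        ultimately have "dist (f s) (f s1) < \<epsilon>" by (intro d(2))
        hence "\<bar>Re (f s - f s1)\<bar> < \<epsilon>"
          unfolding dist_norm by (rule order.strict_trans1[OF abs_Re_le_cmod])
        hence "Re (f s) \<le> Re (f s1) + \<epsilon>" by simp
        also have "Re (f s1) \<le> M" unfolding f_def s1_def by (rule M[OF t])
        also have "f s = cnj w * mangoldt_series s"
          using \<sigma> by (simp add: f_def mangoldt_series_eq s_def)
        finally show "Re (cnj w * mangoldt_series (of_real \<sigma> + \<i> * of_real t)) \<le> M + \<epsilon>"
          by (simp add: s_def)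
      qed
    qed
  qed simp
  note le = this
  show ?thesis
  proof (rule field_le_epsilon)
    fix e :: real assume e: "e > 0"
    \<comment> \<open>The summand 1 avoids having to show that the integral is positive.\<close>
    have "?X \<le> (M + e / (?I + 1)) * ?I"
      using e I0 by (intro le divide_pos_pos) auto
    also have "\<dots> = M * ?I + e * (?I / (?I + 1))" by (simp add: algebra_simps)
    also have "e * (?I / (?I + 1)) \<le> e * 1"
      using e I0 by (intro mult_left_mono) (auto simp: divide_le_eq)
    finally show "?X \<le> M * ?I + e" by simp
  qed
qed

section \<open>Choice of the resonator\<close>

text \<open>Four bounded losses make up \<open>2 + 2 * B0\<close>: 1 from Mertens, \<open>B0\<close>
  for discarding the higher prime powers there, 1 for the factor \<open>L / (L + 1)\<close> in the
  divisor counts, and \<open>B0\<close> for the prime powers dividing \<open>Q\<close>, whose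
  coefficients are at least \<open>- d\<close>.\<close>

lemma resonance_sum_ge:
  obtains B :: real where "B \<ge> 0" "\<And>y L Q. y \<ge> 1 \<Longrightarrow> L \<ge> 1 \<Longrightarrow> ln (real y) \<le> real L + 1 \<Longrightarrow> Q = fact y ^ L \<Longrightarrow>
    (\<Sum>k | k dvd Q. mangoldt k / real k * resonance_coeff Q k) \<ge> real (card {n. n dvd Q}) * (ln (real y) - B)"
proof -
  obtain B0 :: real where B0: "B0 \<ge> 0"
    "\<And>F. finite F \<Longrightarrow> (\<And>k. k \<in> F \<Longrightarrow> \<not> prime k) \<Longrightarrow> (\<Sum>k\<in>F. mangoldt k / real k) \<le> B0"
    by (rule mangoldt_nonprime_sum_le) (rule that, assumption, blast)
  show ?thesis
  proof (rule that[of "2 + 2 * B0"])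
    show "2 + 2 * B0 \<ge> 0" using B0 by simp
    fix y L Q :: nat
    assume y: "y \<ge> 1" and L: "L \<ge> 1" and Ly: "ln (real y) \<le> real L + 1" and Q: "Q = fact y ^ L"
    define d where "d = real (card {n. n dvd Q})"
    define c where "c = (\<lambda>k. mangoldt k / real k)"
    have c0: "c k \<ge> 0" for k by (simp add: c_def mangoldt_nonneg)
    have Q0: "Q > 0" by (simp add: Q)
    have fin: "finite {k. k dvd Q}" using Q0 by simp
    define P where "P = {p. prime p \<and> p \<le> y}"
    have finP: "finite P" by (simp add: P_def)
    have P_dvd: "p ^ L dvd Q" if "p \<in> P" for p
    proof -
      have "p dvd fact y" using that by (auto simp: P_def intro!: dvd_fact prime_ge_1_nat)
      thus ?thesis unfolding Q by (rule dvd_power_same)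
    qed
    have cardE: "d * (real L / (real L + 1)) \<le> resonance_coeff Q p" if "p \<in> P" for p
    proof -
      have p: "prime p" using that by (simp add: P_def)
      have "real (L * card {n. n dvd Q}) \<le> real ((L + 1) * card {n. n * p dvd Q})"
        unfolding of_nat_le_iff using p P_dvd[OF that] Q0 by (rule card_dvd_mult_prime_ge)
      hence "real L * d \<le> (real L + 1) * resonance_coeff Q p"
        using p by (simp add: d_def resonance_coeff_def algebra_simps)
      thus ?thesis by (simp add: field_simps)
    qed
    have coeff_ge: "resonance_coeff Q k \<ge> - d" for k
    proof -
      have "card {n. n * k dvd Q} \<le> card {n. n dvd Q}"
        using fin by (intro card_mono) (auto intro: dvd_mult_left)
      thus ?thesis by (simp add: resonance_coeff_def d_def)
    qed
    have "ln (real y) - 1 \<le> (\<Sum>k=1..y. c k)"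
      unfolding c_def using y by (rule mangoldt_sum_ge)
    also have "\<dots> = (\<Sum>k\<in>P. c k) + (\<Sum>k\<in>{1..y} - P. c k)"
      by (subst sum.subset_diff[of P "{1..y}"]) (auto simp: P_def Suc_le_eq prime_gt_0_nat)
    also have "(\<Sum>k\<in>{1..y} - P. c k) \<le> B0"
      unfolding c_def by (rule B0(2)) (auto simp: P_def)
    finally have sumP: "(\<Sum>k\<in>P. c k) \<ge> ln (real y) - 1 - B0" by simp
    define x where "x = ln (real y) - 1 - B0"
    \<comment> \<open>The factor \<open>L / (L + 1)\<close> loses \<open>x / (L + 1)\<close>, which
      is at most 1 by the size condition relating \<open>L\<close> to \<open>ln y\<close>.\<close>
    have "x \<le> real L + 1" using Ly B0 by (simp add: x_def)
    hence "x - 1 \<le> x * (real L / (real L + 1))"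
      by (simp add: field_simps)
    also have "\<dots> \<le> (\<Sum>k\<in>P. c k) * (real L / (real L + 1))"
      using sumP by (intro mult_right_mono) (auto simp: x_def)
    finally have "d * (x - 1) \<le> d * ((\<Sum>k\<in>P. c k) * (real L / (real L + 1)))"
      by (intro mult_left_mono) (auto simp: d_def)
    also have "\<dots> = (\<Sum>k\<in>P. c k * (d * (real L / (real L + 1))))"
      by (simp add: sum_distrib_left sum_distrib_right sum_divide_distrib mult_ac)
    also have "\<dots> \<le> (\<Sum>k\<in>P. c k * resonance_coeff Q k)"
      by (intro sum_mono mult_left_mono cardE c0)
    also have "\<dots> \<le> (\<Sum>k | k dvd Q \<and> prime k. c k * resonance_coeff Q k)"
    proof (rule sum_mono2)
      show "P \<subseteq> {k. k dvd Q \<and> prime k}"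
      proof
        fix p assume p: "p \<in> P"
        have "p dvd p ^ L" using L by simp
        thus "p \<in> {k. k dvd Q \<and> prime k}" using p P_dvd[OF p] by (auto simp: P_def intro: dvd_trans)
      qed
    qed (use fin c0 in \<open>auto simp: resonance_coeff_def\<close>)
    finally have primes: "d * (x - 1) \<le> (\<Sum>k | k dvd Q \<and> prime k. c k * resonance_coeff Q k)" .
    have "d * - B0 \<le> d * - (\<Sum>k | k dvd Q \<and> \<not> prime k. c k)"
      unfolding c_def using fin by (intro mult_left_mono) (auto simp: d_def intro!: B0(2))
    also have "\<dots> = (\<Sum>k | k dvd Q \<and> \<not> prime k. c k * - d)"
      by (simp add: sum_distrib_left sum_negf mult.commute)
    also have "\<dots> \<le> (\<Sum>k | k dvd Q \<and> \<not> prime k. c k * resonance_coeff Q k)"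
      by (intro sum_mono mult_left_mono coeff_ge c0)
    finally have "d * (x - 1) + d * - B0 \<le> (\<Sum>k | k dvd Q \<and> prime k. c k * resonance_coeff Q k) +
      (\<Sum>k | k dvd Q \<and> \<not> prime k. c k * resonance_coeff Q k)"
      using primes by simp
    also have "\<dots> = (\<Sum>k\<in>{k. k dvd Q \<and> prime k} \<union> {k. k dvd Q \<and> \<not> prime k}. c k * resonance_coeff Q k)"
      using fin by (intro sum.union_disjoint[symmetric]) auto
    also have "{k. k dvd Q \<and> prime k} \<union> {k. k dvd Q \<and> \<not> prime k} = {k. k dvd Q}" by auto
    finally show "real (card {n. n dvd Q}) * (ln (real y) - (2 + 2 * B0)) \<le> (\<Sum>k | k dvd Q. mangoldt k / real k * resonance_coeff Q k)"
      by (simp add: c_def d_def x_def algebra_simps)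
  qed
qed

section \<open>From weighted means to a pointwise bound, and the choice of parameters\<close>

lemma card_divisors_le: "Q > 0 \<Longrightarrow> card {n. n dvd Q} \<le> (Q :: nat)"
  using card_mono[of "{1..Q}" "{n. n dvd Q}"] by (force simp: Suc_le_eq dvd_imp_le intro!: Nat.gr0I)

text \<open>Division by the main mass \<open>v\<close> of the weight. Its error \<eta> gets
  multiplied by \<open>M\<close>, so \<eta> must be small against \<open>v / M\<close> and not just
  against \<open>v\<close>; this is why \<open>W\<close> is compared with the fifth power of
  \<open>Q\<close> instead of the fourth.\<close>

lemma log_deriv_zeta_ge:
  obtains B :: real where "B \<ge> 0" "\<And>y L Q W a w M. y \<ge> 2 \<Longrightarrow> L \<ge> 1 \<Longrightarrow> ln (real y) \<le> real L + 1 \<Longrightarrow>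
    Q = fact y ^ L \<Longrightarrow> W \<ge> 4 * real Q ^ 5 \<Longrightarrow> norm w = 1 \<Longrightarrow> a > 0 \<Longrightarrow> M \<ge> 0 \<Longrightarrow>
    (\<And>t. t \<in> {a..a + 2 * pi * W} \<Longrightarrow>
      Re (cnj w * - (deriv zeta (1 + \<i> * of_real t) / zeta (1 + \<i> * of_real t))) \<le> M) \<Longrightarrow>
    ln (real y) - B \<le> M"
proof -
  obtain B0 :: real where B0: "B0 \<ge> 0" "\<And>y L Q. y \<ge> 1 \<Longrightarrow> L \<ge> 1 \<Longrightarrow> ln (real y) \<le> real L + 1 \<Longrightarrow> Q = fact y ^ L \<Longrightarrow>
    (\<Sum>k | k dvd Q. mangoldt k / real k * resonance_coeff Q k) \<ge> real (card {n. n dvd Q}) * (ln (real y) - B0)"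
    by (rule resonance_sum_ge) (rule that, assumption, blast)
  define S where "S = (\<Sum>k. 1 / (real k * (1 + ln (real k)) ^ 2))"
  have S0: "S \<ge> 0"
    unfolding S_def by (intro suminf_nonneg summable_inverse_ln_sq) auto
  show ?thesis
  proof (rule that[of "B0 + S + 1"])
    show "B0 + S + 1 \<ge> 0" using B0 S0 by simp
    fix y L Q :: nat and W a M :: real and w :: complex
    assume y: "y \<ge> 2" and L: "L \<ge> 1" and Ly: "ln (real y) \<le> real L + 1" and Q: "Q = fact y ^ L"
      and W: "W \<ge> 4 * real Q ^ 5" and w: "norm w = 1" and a: "a > 0" and M0: "M \<ge> 0"
      and M: "\<And>t. t \<in> {a..a + 2 * pi * W} \<Longrightarrow>
        Re (cnj w * - (deriv zeta (1 + \<i> * of_real t) / zeta (1 + \<i> * of_real t))) \<le> M"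
    have "y \<le> fact y" by (rule fact_ge_self)
    also have "\<dots> \<le> Q" using L by (simp add: Q self_le_power)
    finally have yQ: "y \<le> Q" .
    hence Q2: "Q \<ge> 2" using y by simp
    have "real Q ^ 4 \<le> real Q ^ 5" using Q2 by (intro power_increasing) auto
    hence W4: "W \<ge> 4 * real Q ^ 4" using W by linarith
    have Q1: "real Q \<ge> 1" using Q2 by simp
    have W1: "W > 0" using W Q1 by (smt (verit) zero_less_power)
    define d where "d = real (card {n. n dvd Q})"
    define I where "I = integral {a..a + 2 * pi * W} (weight w Q a W)"
    define v where "v = 2 * pi * W * d"
    define \<eta> where "\<eta> = d ^ 2 * (24 * real Q ^ 12 / W ^ 2)"
    have "card {n. n dvd Q} > 0" using Q2 by (subst card_gt_0_iff) auto
    hence d0: "d > 0" by (simp add: d_def)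
    have dQ: "d \<le> real Q" using card_divisors_le[of Q] Q2 by (simp add: d_def)
    have v0: "v > 0" using W1 d0 by (simp add: v_def)
    have \<eta>0: "\<eta> \<ge> 0" by (simp add: \<eta>_def)
    have \<eta>v: "\<eta> * real Q \<le> v"
    proof -
      \<comment> \<open>The 14 is made of 12 from the spacing, one from \<open>d \<le> Q\<close> and
        one from the extra factor \<open>Q\<close>; \<open>W ^ 3\<close> supplies the exponent
        15.\<close>
      have "12 * real Q ^ 14 \<le> 64 * real Q ^ 15"
        using Q1 by (intro mult_mono power_increasing) auto
      also have "\<dots> = (4 * real Q ^ 5) ^ 3" by (simp add: power_mult_distrib flip: power_mult)
      also have "\<dots> \<le> W ^ 3" using W by (intro power_mono) auto
      finally have Q14: "12 * real Q ^ 14 \<le> W ^ 3" .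
      have "d * (24 * real Q ^ 12) * real Q \<le> real Q * (24 * real Q ^ 12) * real Q"
        using dQ by (intro mult_right_mono) auto
      also have "\<dots> = 2 * (12 * real Q ^ 14)" by (simp add: power_numeral_reduce)
      also have "\<dots> \<le> (2 * pi) * W ^ 3"
        using Q14 pi_gt3 W1 by (intro mult_mono) auto
      finally have "d * (24 * real Q ^ 12) * real Q / W ^ 2 \<le> (2 * pi) * W ^ 3 / W ^ 2"
        by (intro divide_right_mono) auto
      hence "d * (d * (24 * real Q ^ 12) * real Q / W ^ 2) \<le> d * ((2 * pi) * W ^ 3 / W ^ 2)"
        using d0 by (intro mult_left_mono) auto
      also have "(2 * pi) * W ^ 3 / W ^ 2 = 2 * pi * W" using W1 by (simp add: power_numeral_reduce)
      finally show ?thesis by (simp add: \<eta>_def v_def power2_eq_square mult_ac)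
    qed
    have \<eta>1: "\<eta> \<le> v"
      using mult_left_mono[OF Q1 \<eta>0] \<eta>v by simp
    have "ln (real y) \<le> real y" using y ln_le_minus_one[of "real y"] by simp
    hence lnQ: "ln (real y) \<le> real Q" using yQ by simp
    have I: "\<bar>I - v\<bar> \<le> \<eta>"
      using weight_integral_error[OF Q2 W4 w, of a] by (simp add: I_def v_def \<eta>_def d_def)
    have "2 * pi * W * (d * (ln (real y) - B0)) - \<eta> * S \<le> M * I"
    proof -
      have "2 * pi * W * (d * (ln (real y) - B0)) \<le> 2 * pi * W * (\<Sum>k | k dvd Q. mangoldt k / real k * resonance_coeff Q k)"
        unfolding d_def using y L Ly Q W1 by (intro mult_left_mono B0(2)) auto
      moreover have "2 * pi * W * (\<Sum>k | k dvd Q. mangoldt k / real k * resonance_coeff Q k) - \<eta> * S \<le> M * I"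
        unfolding I_def \<eta>_def d_def S_def by (rule resonance_lower_bound[OF Q2 W4 w a M])
      ultimately show ?thesis by linarith
    qed
    hence main: "v * (ln (real y) - B0) - \<eta> * S \<le> M * I" by (simp add: v_def mult_ac)
    show "ln (real y) - (B0 + S + 1) \<le> M"
    proof (rule ccontr)
      \<comment> \<open>The contrary assumption bounds \<open>M\<close> by
        \<open>ln y \<le> Q\<close>, so that \<open>M * \<eta>\<close> is at most
        \<open>v\<close>.\<close>
      assume "\<not> ?thesis"
      hence less: "M < ln (real y) - B0 - S - 1" by simp
      have "M * I \<le> M * (v + \<eta>)" using I M0 by (intro mult_left_mono) auto
      moreover have "M * \<eta> \<le> real Q * \<eta>"
        using less lnQ B0(1) S0 \<eta>0 by (intro mult_right_mono) auto
      moreover have "\<eta> * S \<le> v * S" using \<eta>1 S0 by (intro mult_right_mono)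
      ultimately have "v * (ln (real y) - B0) \<le> v * M + v + v * S"
        using main \<eta>v by (simp add: algebra_simps)
      hence "v * (ln (real y) - B0) \<le> v * (M + 1 + S)" by (simp add: algebra_simps)
      hence "ln (real y) - B0 \<le> M + 1 + S" using v0 by simp
      thus False using less by simp
    qed
  qed
qed

lemma ln_fact_le: "ln (fact n) \<le> real n * ln (real n)"
proof (cases "n = 0")
  case False
  have "fact n \<le> real n ^ n" using fact_le_power[of n] by (metis of_nat_fact of_nat_le_iff of_nat_power)
  hence "ln (fact n) \<le> ln (real n ^ n)" using False by (subst ln_le_cancel_iff) auto
  thus ?thesis using False by (simp add: ln_realpow)
qed simp

text \<open>With \<open>m = ln (ln T)\<close>, the choice of \<open>y\<close> gives
  \<open>ln y = m - 2 * ln m + O(1)\<close>, and the constant is absorbed in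
  \<open>3 * ln m\<close>. The power \<open>Q ^ 5\<close> stays below the square root of
  \<open>T\<close>, hence far below the length of the window.\<close>

lemma resonator_parameters:
  fixes \<beta> :: real
  assumes "0 < \<beta>" "\<beta> < 1"
  shows "eventually (\<lambda>T. \<exists>y L. y \<ge> 2 \<and> L \<ge> 1 \<and> ln (real y) \<le> real L + 1 \<and>
    4 * real (fact y ^ L) ^ 5 \<le> (T - T powr \<beta>) / (2 * pi) \<and> ln (real y) \<ge> ln (ln T) - 3 * ln (ln (ln T))) at_top"
proof -
  have "eventually (\<lambda>T::real. T > 1) at_top" by real_asymp
  moreover have "eventually (\<lambda>T::real. ln (ln T) \<ge> 1) at_top" by real_asymp
  moreover have "eventually (\<lambda>T::real. ln T / (20 * ln (ln T) ^ 2) - 1 \<ge> 2) at_top" by real_asymp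
  moreover have "eventually (\<lambda>T::real. ln (ln T / (20 * ln (ln T) ^ 2) - 1) \<ge> ln (ln T) - 3 * ln (ln (ln T))) at_top"
    by real_asymp
  moreover have "eventually (\<lambda>T::real. 4 * T powr (1/2) \<le> (T - T powr \<beta>) / (2 * pi)) at_top"
    using assms by real_asymp
  ultimately show ?thesis
  proof eventually_elim
    case (elim T)
    define l where "l = ln T"
    define m where "m = ln l"
    \<comment> \<open>From \<open>L \<le> 2 * m\<close> and \<open>ln y \<le> m\<close> follows
      \<open>ln Q \<le> 2 * m * z * m\<close>, and 20 makes this \<open>l / 10\<close>; five times
      that is half of \<open>ln T\<close>.\<close>
    define z where "z = l / (20 * m ^ 2)"
    define y where "y = nat \<lfloor>z\<rfloor>"
    define L where "L = nat \<lceil>m\<rceil>"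
    have m: "m \<ge> 1" using elim by (simp add: m_def l_def)
    have l: "l > 0" using elim by (simp add: l_def)
    have z: "z - 1 \<ge> 2" "ln (z - 1) \<ge> m - 3 * ln m"
      using elim by (simp_all add: z_def m_def l_def)
    have y: "real y \<le> z" "real y \<ge> z - 1" "y \<ge> 2"
      using z unfolding y_def by linarith+
    have L: "real L \<ge> m" "real L \<le> m + 1" "L \<ge> 1"
      using m unfolding L_def by linarith+
    have "1 \<le> m ^ 2" using m by simp
    hence "l * 1 \<le> l * (20 * m ^ 2)" using l by (intro mult_left_mono) auto
    hence "z \<le> l" using m by (simp add: z_def divide_le_eq)
    hence "ln (real y) \<le> ln l" using y by (subst ln_le_cancel_iff) (use l in auto)
    hence lny: "ln (real y) \<le> m" by (simp add: m_def)
    have lny0: "ln (real y) \<ge> 0" using y by simp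
    define Q :: nat where "Q = fact y ^ L"
    have "ln (real Q) = real L * ln (fact y)" by (simp add: Q_def ln_realpow)
    also have "\<dots> \<le> real L * (real y * ln (real y))"
      by (intro mult_left_mono ln_fact_le) auto
    also have "\<dots> \<le> (2 * m) * (z * m)"
      using L m y z lny lny0 by (intro mult_mono mult_nonneg_nonneg) auto
    also have "\<dots> = l / 10"
      using m by (simp add: z_def power2_eq_square)
    finally have "5 * ln (real Q) \<le> l / 2" by simp
    moreover have Q0: "real Q > 0" by (simp add: Q_def)
    ultimately have "ln (real Q ^ 5) \<le> ln (T powr (1/2))"
      using elim by (simp add: ln_realpow ln_powr l_def)
    hence "real Q ^ 5 \<le> T powr (1/2)"
      using Q0 elim by (subst (asm) ln_le_cancel_iff) auto
    hence "4 * real (fact y ^ L) ^ 5 \<le> (T - T powr \<beta>) / (2 * pi)"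
      using elim unfolding Q_def by linarith
    moreover have "ln (real y) \<ge> ln (ln T) - 3 * ln (ln (ln T))"
    proof -
      have "ln (z - 1) \<le> ln (real y)" using y z by (subst ln_le_cancel_iff) auto
      thus ?thesis using z(2) by (simp add: m_def l_def)
    qed
    ultimately show ?case using y(3) L lny by (intro exI[of _ y] exI[of _ L]) auto
  qed
qed

lemma continuous_on_log_deriv_zeta:
  assumes "0 \<notin> A"
  shows "continuous_on A (\<lambda>t. deriv zeta (1 + \<i> * of_real t) / zeta (1 + \<i> * of_real t))"
proof -
  have hol: "deriv zeta holomorphic_on (- {1})"
    by (intro holomorphic_deriv zeta_holomorphic) auto
  have img: "(\<lambda>t. 1 + \<i> * complex_of_real t) ` A \<subseteq> - {1}" using assms by auto
  have nz: "zeta (1 + \<i> * of_real t) \<noteq> 0" if "t \<in> A" for t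
    using that assms by (intro zeta_nonzero_Re_eq_1) auto
  show ?thesis
    using nz
    by (intro continuous_on_divide ballI
        continuous_on_compose2[OF holomorphic_on_imp_continuous_on[OF hol] _ img]
        continuous_on_compose2[OF holomorphic_on_imp_continuous_on[OF zeta_holomorphic] _ img] continuous_intros) auto
qed

text \<open>The maximum is expressed by an attained maximizer, which exists by compactness. The
  resonance argument covers large \<open>T\<close> only; on the remaining bounded range of
  \<open>T\<close> a crude bound for the logarithmic derivative is absorbed in the constant.\<close>

theorem theorem7:
  fixes \<beta> :: real
  assumes "0 < \<beta>" and "\<beta> < 1"
  shows "\<exists>C>0. \<forall>T\<ge>10^10. \<forall>\<theta>\<in>{0..2*pi}. \<exists>t\<^sub>0::real.
           is_arg_max
             (\<lambda>t. Re (exp (- \<i> * of_real \<theta>) *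
                      (deriv zeta (1 + \<i> * of_real t) / zeta (1 + \<i> * of_real t))))
             (\<lambda>t. T powr \<beta> \<le> \<bar>t\<bar> \<and> \<bar>t\<bar> \<le> T) t\<^sub>0 \<and>
           Re (exp (- \<i> * of_real \<theta>) *
               (deriv zeta (1 + \<i> * of_real t\<^sub>0) / zeta (1 + \<i> * of_real t\<^sub>0)))
             \<ge> ln (ln T) - C * ln (ln (ln T))"
proof -
  define F where "F = (\<lambda>t. deriv zeta (1 + \<i> * of_real t) / zeta (1 + \<i> * of_real t))"
  define g where "g = (\<lambda>\<theta> t. Re (exp (- \<i> * of_real \<theta>) * F t))"
  obtain B where B0: "B \<ge> 0" and B: "\<And>y L Q W a w M. y \<ge> 2 \<Longrightarrow> L \<ge> 1 \<Longrightarrow> ln (real y) \<le> real L + 1 \<Longrightarrow>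
    Q = fact y ^ L \<Longrightarrow> W \<ge> 4 * real Q ^ 5 \<Longrightarrow> norm w = 1 \<Longrightarrow> a > 0 \<Longrightarrow> M \<ge> 0 \<Longrightarrow>
    (\<And>t. t \<in> {a..a + 2 * pi * W} \<Longrightarrow>
      Re (cnj w * - (deriv zeta (1 + \<i> * of_real t) / zeta (1 + \<i> * of_real t))) \<le> M) \<Longrightarrow>
    ln (real y) - B \<le> M"
    by (rule log_deriv_zeta_ge) (rule that, assumption, blast)
  have "eventually (\<lambda>T::real. ln (ln (ln T)) \<ge> 1) at_top" by real_asymp
  moreover have "eventually (\<lambda>T::real. ln (ln T) - 3 * ln (ln (ln T)) - B > 0) at_top" by real_asymp
  ultimately have "eventually (\<lambda>T. ln (ln (ln T)) \<ge> 1 \<and> ln (ln T) - 3 * ln (ln (ln T)) - B > 0 \<and>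
    (\<exists>y L. y \<ge> 2 \<and> L \<ge> 1 \<and> ln (real y) \<le> real L + 1 \<and>
    4 * real (fact y ^ L) ^ 5 \<le> (T - T powr \<beta>) / (2 * pi) \<and> ln (real y) \<ge> ln (ln T) - 3 * ln (ln (ln T)))) at_top"
    using resonator_parameters[OF assms] by eventually_elim auto
  then obtain T0' where T0': "\<And>T. T \<ge> T0' \<Longrightarrow> ln (ln (ln T)) \<ge> 1 \<and> ln (ln T) - 3 * ln (ln (ln T)) - B > 0 \<and>
    (\<exists>y L. y \<ge> 2 \<and> L \<ge> 1 \<and> ln (real y) \<le> real L + 1 \<and>
    4 * real (fact y ^ L) ^ 5 \<le> (T - T powr \<beta>) / (2 * pi) \<and> ln (real y) \<ge> ln (ln T) - 3 * ln (ln (ln T)))"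
    unfolding eventually_at_top_linorder by blast
  define T0 where "T0 = max T0' (10 ^ 10)"
  have "continuous_on {10 ^ 10..T0} F"
    unfolding F_def by (intro continuous_on_log_deriv_zeta) simp
  then obtain K where K: "K \<ge> 0" "\<And>t. t \<in> {10 ^ 10..T0} \<Longrightarrow> norm (F t) \<le> K"
    by (rule continuous_on_compact_bound[OF compact_Icc]) (rule that, assumption, blast)
  \<comment> \<open>This makes \<open>ln (ln (ln T))\<close> positive on the whole range, with
    minimum \<open>c\<close>, so that a large constant can absorb any bounded quantity.\<close>
  have "exp (exp 1) < (10 ^ 10 :: real)"
  proof -
    have "exp (exp 1) \<le> exp (3::real)" using exp_le by simp
    also have "exp (3::real) = exp 1 ^ 3" by (simp flip: exp_of_nat_mult)
    also have "\<dots> \<le> 3 ^ 3" using exp_le by (intro power_mono) auto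
    also have "\<dots> < (10 ^ 10 :: real)" by simp
    finally show ?thesis .
  qed
  note ee = this
  have ln10: "ln T > exp 1" if "T \<ge> 10 ^ 10" for T :: real
  proof -
    have "ln (exp (exp 1)) < ln T" using that ee by (intro ln_less_cancel_iff[THEN iffD2]) auto
    thus ?thesis by simp
  qed
  have lnln10: "ln (ln T) > 1" if "T \<ge> 10 ^ 10" for T :: real
  proof -
    have "ln (exp 1) < ln (ln T)"
      using ln10[OF that] by (intro ln_less_cancel_iff[THEN iffD2]) (auto intro: less_trans[OF exp_gt_zero])
    thus ?thesis by simp
  qed
  define c where "c = ln (ln (ln (10 ^ 10 :: real)))"
  have c: "c > 0" unfolding c_def by (rule ln_gt_zero[OF lnln10]) simp
  \<comment> \<open>The part \<open>3 + B\<close> serves large \<open>T\<close>, where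
    \<open>ln (ln (ln T)) \<ge> 1\<close> absorbs \<open>B\<close>; the quotient serves
    \<open>T < T0\<close>, where \<open>C * c\<close> must exceed
    \<open>K + ln (ln T0)\<close>.\<close>
  define C where "C = 3 + B + (K + ln (ln T0)) / c"
  have T0: "T0 \<ge> 10 ^ 10" by (simp add: T0_def)
  have C3: "C \<ge> 3 + B" using K(1) c lnln10[OF T0] by (simp add: C_def)
  show ?thesis
  proof (rule exI[of _ C], intro conjI allI impI ballI)
    show "C > 0" using C3 B0 by simp
    fix T \<theta> :: real assume T: "T \<ge> 10 ^ 10" and \<theta>: "\<theta> \<in> {0..2 * pi}"
    define A where "A = {t. T powr \<beta> \<le> \<bar>t\<bar> \<and> \<bar>t\<bar> \<le> T}"
    have T1: "T > 1" using T by simp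
    hence TT: "T powr \<beta> \<le> T" using powr_mono[of \<beta> 1 T] assms by simp
    have "0 \<notin> A" using T1 by (auto simp: A_def)
    hence cont: "continuous_on A (g \<theta>)"
      unfolding g_def F_def by (intro continuous_intros continuous_on_log_deriv_zeta)
    have "A = {-T..T} \<inter> {t. T powr \<beta> \<le> \<bar>t\<bar>}" by (auto simp: A_def)
    moreover have "closed {t. T powr \<beta> \<le> \<bar>t\<bar>}" by (intro closed_Collect_le continuous_intros)
    ultimately have "compact A" by (simp add: compact_Int_closed)
    moreover have TA: "T \<in> A" using TT T1 by (simp add: A_def)
    ultimately obtain t0 where t0: "t0 \<in> A" "\<And>t. t \<in> A \<Longrightarrow> g \<theta> t \<le> g \<theta> t0"
      using continuous_attains_sup[of A "g \<theta>"] cont by blast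
    have "g \<theta> t0 \<ge> ln (ln T) - C * ln (ln (ln T))"
    proof (cases "T \<ge> T0")
      case True
      hence "T \<ge> T0'" by (simp add: T0_def)
      from T0'[OF this] obtain y L where yL: "ln (ln (ln T)) \<ge> 1" "ln (ln T) - 3 * ln (ln (ln T)) - B > 0"
        "y \<ge> 2" "L \<ge> 1" "ln (real y) \<le> real L + 1"
        "4 * real (fact y ^ L) ^ 5 \<le> (T - T powr \<beta>) / (2 * pi)" "ln (real y) \<ge> ln (ln T) - 3 * ln (ln (ln T))"
        by blast
      \<comment> \<open>The sign cancels the one in front of
        \<open>deriv zeta / zeta\<close>.\<close>
      define w where "w = - exp (\<i> * of_real \<theta>)"
      \<comment> \<open>The \<open>max\<close> supplies the nonnegative bound \<open>M\<close> that
        is required; it is removed afterwards because \<open>ln y - B\<close> is positive. The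
        window is exactly the positive half of \<open>A\<close>.\<close>
      have "ln (real y) - B \<le> max 0 (g \<theta> t0)"
      proof (rule B[OF yL(3-5) refl yL(6)])
        show "norm w = 1" by (simp add: w_def)
        show "T powr \<beta> > 0" using T1 by simp
        fix t assume "t \<in> {T powr \<beta>..T powr \<beta> + 2 * pi * ((T - T powr \<beta>) / (2 * pi))}"
        hence "T powr \<beta> \<le> t" "t \<le> T" by simp_all
        moreover have "T powr \<beta> > 0" using T1 by simp
        ultimately have "t > 0" "T powr \<beta> \<le> t" "t \<le> T" by linarith+
        hence "t \<in> A" unfolding A_def by simp
        have "cnj w * - F t = exp (- \<i> * of_real \<theta>) * F t"
          by (simp add: w_def exp_cnj)
        hence "Re (cnj w * - F t) = g \<theta> t" by (simp add: g_def)
        also have "\<dots> \<le> max 0 (g \<theta> t0)" using t0(2)[OF \<open>t \<in> A\<close>] by simp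
        finally show "Re (cnj w * - (deriv zeta (1 + \<i> * of_real t) / zeta (1 + \<i> * of_real t))) \<le> max 0 (g \<theta> t0)"
          by (simp add: F_def)
      qed simp
      hence "ln (ln T) - 3 * ln (ln (ln T)) - B \<le> g \<theta> t0" using yL(2,7) by linarith
      moreover have "B * 1 \<le> B * ln (ln (ln T))" using yL(1) B0 by (intro mult_left_mono)
      moreover have "(3 + B) * ln (ln (ln T)) \<le> C * ln (ln (ln T))"
        using C3 yL(1) by (intro mult_right_mono) auto
      ultimately show ?thesis by (simp add: algebra_simps)
    next
      case False
      \<comment> \<open>The end point \<open>T\<close> belongs to \<open>A\<close>, so the value
        there already bounds the maximum from below by \<open>- K\<close>.\<close>
      have "\<bar>g \<theta> T\<bar> \<le> norm (exp (- \<i> * of_real \<theta>) * F T)" unfolding g_def by (rule abs_Re_le_cmod)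
      also have "\<dots> = norm (F T)" by (simp add: norm_mult)
      also have "\<dots> \<le> K" using T False by (intro K(2)) auto
      finally have "- K \<le> g \<theta> t0" using t0(2)[OF TA] by linarith
      moreover have "K + ln (ln T) \<le> C * ln (ln (ln T))"
      proof -
        have "ln (ln T) \<le> ln (ln T0)"
        proof -
          have "ln T \<le> ln T0" using False T1 by simp
          moreover have "ln T > 0" using T1 by simp
          ultimately show ?thesis by (rule ln_mono)
        qed
        hence "K + ln (ln T) \<le> (K + ln (ln T0)) / c * c" using c by simp
        also have "\<dots> \<le> C * c" using c B0 by (intro mult_right_mono) (auto simp: C_def)
        also have "c \<le> ln (ln (ln T))"
        proof -
          have "ln (10 ^ 10) \<le> ln T" using T by simp
          hence "ln (ln (10 ^ 10)) \<le> ln (ln T)" by (subst ln_le_cancel_iff) (use T1 in auto)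
          thus ?thesis unfolding c_def
            by (rule ln_mono) (rule less_trans[OF zero_less_one lnln10], simp)
        qed
        hence "C * c \<le> C * ln (ln (ln T))" using C3 B0 by (intro mult_left_mono) auto
        finally show ?thesis .
      qed
      ultimately show ?thesis by linarith
    qed
    moreover have "is_arg_max (g \<theta>) (\<lambda>t. T powr \<beta> \<le> \<bar>t\<bar> \<and> \<bar>t\<bar> \<le> T) t0"
      using t0 by (simp add: is_arg_max_linorder A_def)
    ultimately show "\<exists>t\<^sub>0::real.
           is_arg_max
             (\<lambda>t. Re (exp (- \<i> * of_real \<theta>) *
                      (deriv zeta (1 + \<i> * of_real t) / zeta (1 + \<i> * of_real t))))
             (\<lambda>t. T powr \<beta> \<le> \<bar>t\<bar> \<and> \<bar>t\<bar> \<le> T) t\<^sub>0 \<and>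
           Re (exp (- \<i> * of_real \<theta>) *
               (deriv zeta (1 + \<i> * of_real t\<^sub>0) / zeta (1 + \<i> * of_real t\<^sub>0)))
             \<ge> ln (ln T) - C * ln (ln (ln T))"
      unfolding g_def F_def by blast
  qed
qed

end
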